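(* Let $\alpha,\beta,\gamma$ be constants with $\alpha+\beta+\gamma=0$, and consider the general heavenly equation $$\alpha u_{12}u_{34}+\beta u_{13}u_{24}+\gamma u_{14}u_{23}=0$$ for a holomorphic function $u=u(z_1,z_2,z_3,z_4)$ of four complex variables. Put $L_{ij(k)}=u_{jk}D_i-u_{ik}D_j$. The general heavenly equation admits the following three different Lax pairs (with spectral parameter $\lambda$) and three respective recursion operators, defined by the relations between $\varphi$ and $\psi$ given with each pair. (1) Lax pair $$X_1^{(1)}=L_{14(3)}+\lambda\gamma L_{13(4)},\qquad X_2^{(1)}=-L_{24(3)}+\lambda\beta L_{23(4)},$$ and recursion operator defined by $$L_{14(3)}\varphi=\gamma L_{13(4)}\psi,\qquad L_{24(3)}\varphi=-\beta L_{23(4)}\psi .$$ (2) Lax pair $$X_1^{(2)}=L_{23(1)}+\lambda\gamma L_{13(2)},\qquad X_2^{(2)}=L_{24(1)}-\lambda\beta L_{14(2)},$$ and recursion operator defined by $$L_{23(1)}\varphi=\gamma L_{13(2)}\psi,\qquad L_{24(1)}\varphi=-\beta L_{14(2)}\psi .$$ (3) Lax pair $$X_1^{(3)}=L_{41(2)}+\lambda\gamma L_{42(1)},\qquad X_2^{(3)}=-L_{31(2)}+\lambda\beta L_{32(1)},$$ and recursion operator defined by $$L_{41(2)}\varphi=\gamma L_{42(1)}\psi,\qquad L_{31(2)}\varphi=-\beta L_{32(1)}\psi .$$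
   Context: Here $u_{ij}=\partial^2u/\partial z_i\partial z_j$ and $D_i$ is the total derivative with respect to $z_i$, so that each $L_{ij(k)}$ is a first-order linear differential operator with $L_{ji(k)}=-L_{ij(k)}$. "Lax pair" has its usual meaning for $\lambda$-dependent vector fields: the two operators are compatible (in involution) for all $\lambda$ on solutions $u$ of the equation. A symmetry characteristic of the equation is a $\varphi$ satisfying, on solutions $u$, the symmetry condition (the linearization of the equation) $$\hat A\varphi=\alpha(u_{34}\varphi_{12}+u_{12}\varphi_{34})+\beta(u_{24}\varphi_{13}+u_{13}\varphi_{24})+\gamma(u_{23}\varphi_{14}+u_{14}\varphi_{23})=0 .$$ A recursion operator maps any symmetry (characteristic) again into a symmetry. The recursion operators here are nonlocal and are given implicitly by the displayed pairs of relations between two symmetries $\varphi$ and $\psi$; a pair of relations is said to determine a recursion operator because its integrability conditions are the symmetry conditions $\hat A\psi=0$ and $\hat A\varphi=0$, so that both $\varphi$ and $\psi$ are symmetry characteristics. Pairs (2) and (3) arise from (1) by the index permutations $1\leftrightarrow3,\ 2\leftrightarrow4$ and $1\leftrightarrow4,\ 2\leftrightarrow3$, which leave the equation and its symmetry condition invariant.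
   Formalization: For the recursion operators, u_34 (pair 1) or u_12 (pairs 2, 3) is assumed not identically zero; the relations are locally solvable near points where it is nonzero, and solving for ψ from φ assumes β and γ nonzero. *)

theory Defs
  imports "HOL-Analysis.Analysis"
begin

text \<open>
  Coordinates on \<open>\<complex>\<^sup>4\<close> are indexed by the library type \<open>4\<close>, whose elements are \<open>1, 2, 3, 4\<close>
  (with \<open>4 = 0\<close>).
\<close>

type_synonym fn = "complex ^ 4 \<Rightarrow> complex"
type_synonym op = "fn \<Rightarrow> fn"

text \<open>Holomorphy in several variables: a complex-linear Frechet derivative at every point.\<close>

definition holo :: "fn \<Rightarrow> (complex ^ 4) set \<Rightarrow> bool" where
  "holo f S \<longleftrightarrow>
     (\<forall>z\<in>S. \<exists>f'. (f has_derivative f') (at z) \<and> (\<forall>c v. f' (c *s v) = c * f' v))"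

definition pd :: "4 \<Rightarrow> op" where
  "pd i f z = deriv (\<lambda>w. f (z + axis i w)) 0"

text \<open>
  Everything is evaluated along a given solution \<open>u\<close>, where the total derivative \<open>D\<^sub>i\<close> is the partial
  derivative \<open>pd i\<close>.
\<close>

definition L :: "fn \<Rightarrow> 4 \<Rightarrow> 4 \<Rightarrow> 4 \<Rightarrow> op" where
  "L u i j k f z = pd j (pd k u) z * pd i f z - pd i (pd k u) z * pd j f z"

definition ghe_solution ::
  "complex \<Rightarrow> complex \<Rightarrow> complex \<Rightarrow> (complex ^ 4) set \<Rightarrow> fn \<Rightarrow> bool" where
  "ghe_solution \<alpha> \<beta> \<gamma> \<Omega> u \<longleftrightarrow>
     open \<Omega> \<and> connected \<Omega> \<and> \<Omega> \<noteq> {} \<and> holo u \<Omega> \<and>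
     (\<forall>z\<in>\<Omega>. \<alpha> * pd 1 (pd 2 u) z * pd 3 (pd 4 u) z
           + \<beta> * pd 1 (pd 3 u) z * pd 2 (pd 4 u) z
           + \<gamma> * pd 1 (pd 4 u) z * pd 2 (pd 3 u) z = 0)"

definition A_hat :: "complex \<Rightarrow> complex \<Rightarrow> complex \<Rightarrow> fn \<Rightarrow> op" where
  "A_hat \<alpha> \<beta> \<gamma> u \<phi> z =
     \<alpha> * (pd 3 (pd 4 u) z * pd 1 (pd 2 \<phi>) z + pd 1 (pd 2 u) z * pd 3 (pd 4 \<phi>) z)
   + \<beta> * (pd 2 (pd 4 u) z * pd 1 (pd 3 \<phi>) z + pd 1 (pd 3 u) z * pd 2 (pd 4 \<phi>) z)
   + \<gamma> * (pd 2 (pd 3 u) z * pd 1 (pd 4 \<phi>) z + pd 1 (pd 4 u) z * pd 2 (pd 3 \<phi>) z)"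

definition symmetry ::
  "complex \<Rightarrow> complex \<Rightarrow> complex \<Rightarrow> fn \<Rightarrow> (complex ^ 4) set \<Rightarrow> fn \<Rightarrow> bool" where
  "symmetry \<alpha> \<beta> \<gamma> u U \<phi> \<longleftrightarrow> holo \<phi> U \<and> (\<forall>z\<in>U. A_hat \<alpha> \<beta> \<gamma> u \<phi> z = 0)"


section \<open>Lax pairs\<close>

definition commutator :: "op \<Rightarrow> op \<Rightarrow> op" where
  "commutator X Y f z = X (Y f) z - Y (X f) z"

definition indep_at :: "(complex ^ 4) set \<Rightarrow> op \<Rightarrow> op \<Rightarrow> complex ^ 4 \<Rightarrow> bool" where
  "indep_at \<Omega> X Y z \<longleftrightarrow>
     (\<forall>p q. (\<forall>f. holo f \<Omega> \<longrightarrow> p * X f z + q * Y f z = 0) \<longrightarrow> p = 0 \<and> q = 0)"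

text \<open>
  The commutator of \<open>X\<close> and \<open>Y\<close> is a combination of \<open>X\<close> and \<open>Y\<close> whose coefficients \<open>b / a\<close> and \<open>c / a\<close>
  are meromorphic on \<open>\<Omega>\<close> and have no poles where \<open>X\<close> and \<open>Y\<close> are linearly independent.
  Poles cannot be excluded altogether: for the first Lax pair below, the commutator can leave the
  span of the two operators at points where \<open>u\<^sub>3\<^sub>4 = 0\<close>.
\<close>

definition in_involution :: "(complex ^ 4) set \<Rightarrow> op \<Rightarrow> op \<Rightarrow> bool" where
  "in_involution \<Omega> X Y \<longleftrightarrow>
     (\<exists>a b c. holo a \<Omega> \<and> holo b \<Omega> \<and> holo c \<Omega> \<and>
        (\<exists>z\<in>\<Omega>. a z \<noteq> 0) \<and> (\<forall>z\<in>\<Omega>. indep_at \<Omega> X Y z \<longrightarrow> a z \<noteq> 0) \<and>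
        (\<forall>f. holo f \<Omega> \<longrightarrow> (\<forall>z\<in>\<Omega>. a z * commutator X Y f z = b z * X f z + c z * Y f z)))"

text \<open>A pair of operators depending on \<open>u\<close> and on the spectral parameter.\<close>

type_synonym op_pair = "fn \<Rightarrow> complex \<Rightarrow> op \<times> op"

definition is_lax_pair :: "complex \<Rightarrow> complex \<Rightarrow> complex \<Rightarrow> op_pair \<Rightarrow> bool" where
  "is_lax_pair \<alpha> \<beta> \<gamma> P \<longleftrightarrow>
     (\<forall>\<Omega> u. ghe_solution \<alpha> \<beta> \<gamma> \<Omega> u \<longrightarrow> (\<forall>l. in_involution \<Omega> (fst (P u l)) (snd (P u l))))"

definition lax_pair_1 :: "complex \<Rightarrow> complex \<Rightarrow> op_pair" where
  "lax_pair_1 \<beta> \<gamma> u l =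
     (\<lambda>f z. L u 1 4 3 f z + l * \<gamma> * L u 1 3 4 f z,
      \<lambda>f z. - L u 2 4 3 f z + l * \<beta> * L u 2 3 4 f z)"

definition lax_pair_2 :: "complex \<Rightarrow> complex \<Rightarrow> op_pair" where
  "lax_pair_2 \<beta> \<gamma> u l =
     (\<lambda>f z. L u 2 3 1 f z + l * \<gamma> * L u 1 3 2 f z,
      \<lambda>f z. L u 2 4 1 f z - l * \<beta> * L u 1 4 2 f z)"

definition lax_pair_3 :: "complex \<Rightarrow> complex \<Rightarrow> op_pair" where
  "lax_pair_3 \<beta> \<gamma> u l =
     (\<lambda>f z. L u 4 1 2 f z + l * \<gamma> * L u 4 2 1 f z,
      \<lambda>f z. - L u 3 1 2 f z + l * \<beta> * L u 3 2 1 f z)"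

definition spanned_at :: "(complex ^ 4) set \<Rightarrow> op \<Rightarrow> op \<times> op \<Rightarrow> complex ^ 4 \<Rightarrow> bool" where
  "spanned_at \<Omega> Z P z \<longleftrightarrow>
     (\<exists>p q. \<forall>f. holo f \<Omega> \<longrightarrow> Z f z = p * fst P f z + q * snd P f z)"

definition same_span_at ::
  "(complex ^ 4) set \<Rightarrow> op \<times> op \<Rightarrow> op \<times> op \<Rightarrow> complex ^ 4 \<Rightarrow> bool" where
  "same_span_at \<Omega> P Q z \<longleftrightarrow>
     spanned_at \<Omega> (fst P) Q z \<and> spanned_at \<Omega> (snd P) Q z \<and>
     spanned_at \<Omega> (fst Q) P z \<and> spanned_at \<Omega> (snd Q) P z"

text \<open>
  Two Lax pairs count as equal if, for the same value of the spectral parameter, they span the same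
  planes at all generic points of all solutions. So the negation excludes more than literal equality
  of the operators (pairs that differ by a linear recombination are not different), but the
  spectral parameter is not allowed to be changed from one pair to the other.
\<close>

definition equivalent_pairs ::
  "complex \<Rightarrow> complex \<Rightarrow> complex \<Rightarrow> op_pair \<Rightarrow> op_pair \<Rightarrow> bool" where
  "equivalent_pairs \<alpha> \<beta> \<gamma> P Q \<longleftrightarrow>
     (\<forall>\<Omega> u l z. ghe_solution \<alpha> \<beta> \<gamma> \<Omega> u \<and> z \<in> \<Omega> \<and> (\<forall>i j. i \<noteq> j \<longrightarrow> pd i (pd j u) z \<noteq> 0)
        \<longrightarrow> same_span_at \<Omega> (P u l) (Q u l) z)"


section \<open>Recursion operators\<close>

text \<open>\<open>R u \<phi> \<psi> z\<close> expresses that the pair of relations between \<open>\<phi>\<close> and \<open>\<psi>\<close> holds at \<open>z\<close>.\<close>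

type_synonym relations = "fn \<Rightarrow> fn \<Rightarrow> fn \<Rightarrow> complex ^ 4 \<Rightarrow> bool"

definition relations_1 :: "complex \<Rightarrow> complex \<Rightarrow> relations" where
  "relations_1 \<beta> \<gamma> u \<phi> \<psi> z \<longleftrightarrow>
     L u 1 4 3 \<phi> z = \<gamma> * L u 1 3 4 \<psi> z \<and> L u 2 4 3 \<phi> z = - \<beta> * L u 2 3 4 \<psi> z"

definition relations_2 :: "complex \<Rightarrow> complex \<Rightarrow> relations" where
  "relations_2 \<beta> \<gamma> u \<phi> \<psi> z \<longleftrightarrow>
     L u 2 3 1 \<phi> z = \<gamma> * L u 1 3 2 \<psi> z \<and> L u 2 4 1 \<phi> z = - \<beta> * L u 1 4 2 \<psi> z"

definition relations_3 :: "complex \<Rightarrow> complex \<Rightarrow> relations" where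
  "relations_3 \<beta> \<gamma> u \<phi> \<psi> z \<longleftrightarrow>
     L u 4 1 2 \<phi> z = \<gamma> * L u 4 2 1 \<psi> z \<and> L u 3 1 2 \<phi> z = - \<beta> * L u 3 2 1 \<psi> z"

text \<open>
  The relations \<open>R\<close> determine a recursion operator: any \<open>\<phi>\<close> and \<open>\<psi>\<close> related by \<open>R\<close> are symmetries,
  and the symmetry conditions suffice for integrability, that is, for a symmetry \<open>\<psi>\<close> the relations
  are locally solvable for \<open>\<phi>\<close> and vice versa. The operator is nonlocal and many-valued, so it is a
  relation between local symmetries rather than a function.

  The indices \<open>i\<close> and \<open>j\<close> name the second derivative of \<open>u\<close> that multiplies the leading terms of all
  the operators in \<open>R\<close>; if it vanishes identically then the relations degenerate (all are \<open>0 = 0\<close> for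
  \<open>u = z\<^sub>1 z\<^sub>2\<close> in the first pair). Solvability for \<open>\<psi>\<close> needs \<open>\<beta>\<close> and \<open>\<gamma>\<close> nonzero, since
  otherwise \<open>\<psi>\<close> drops out of one of the relations.
\<close>

definition determines_recursion_operator ::
  "complex \<Rightarrow> complex \<Rightarrow> complex \<Rightarrow> 4 \<Rightarrow> 4 \<Rightarrow> relations \<Rightarrow> bool" where
  "determines_recursion_operator \<alpha> \<beta> \<gamma> i j R \<longleftrightarrow>
     (\<forall>\<Omega> u. ghe_solution \<alpha> \<beta> \<gamma> \<Omega> u \<and> (\<exists>z\<in>\<Omega>. pd i (pd j u) z \<noteq> 0) \<longrightarrow>
        (\<forall>U \<phi> \<psi>. open U \<and> U \<subseteq> \<Omega> \<and> holo \<phi> U \<and> holo \<psi> U \<and> (\<forall>z\<in>U. R u \<phi> \<psi> z)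
           \<longrightarrow> symmetry \<alpha> \<beta> \<gamma> u U \<phi> \<and> symmetry \<alpha> \<beta> \<gamma> u U \<psi>) \<and>
        (\<forall>U \<psi> p. open U \<and> U \<subseteq> \<Omega> \<and> symmetry \<alpha> \<beta> \<gamma> u U \<psi> \<and> p \<in> U \<and> pd i (pd j u) p \<noteq> 0
           \<longrightarrow> (\<exists>V \<phi>. open V \<and> p \<in> V \<and> V \<subseteq> U \<and> holo \<phi> V \<and> (\<forall>z\<in>V. R u \<phi> \<psi> z))) \<and>
        (\<beta> \<noteq> 0 \<and> \<gamma> \<noteq> 0 \<longrightarrow>
         (\<forall>U \<phi> p. open U \<and> U \<subseteq> \<Omega> \<and> symmetry \<alpha> \<beta> \<gamma> u U \<phi> \<and> p \<in> U \<and> pd i (pd j u) p \<noteq> 0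
            \<longrightarrow> (\<exists>V \<psi>. open V \<and> p \<in> V \<and> V \<subseteq> U \<and> holo \<psi> V \<and> (\<forall>z\<in>V. R u \<phi> \<psi> z)))))"

end

theory Submission
  imports Defs "HOL-Complex_Analysis.Conformal_Mappings"
begin

text \<open>
  Write \<open>H = u\<^sub>c\<^sub>d\<close> for the derivative that multiplies the leading terms of a pair. The three pairs are
  one pair in the index orders \<open>(a, b, c, d) = (1, 2, 3, 4), (3, 4, 1, 2), (4, 3, 2, 1)\<close>, under
  which the equation is invariant. Involutivity and integrability are polynomial identities in the
  jets of \<open>u\<close> and of the test functions, modulo the equation and its first derivatives in the
  directions \<open>c\<close> and \<open>d\<close>. They hold after multiplication by a power of \<open>H\<close>, which is cancelled where
  \<open>H \<noteq> 0\<close>; the identity theorem extends the symmetry conditions to the zeros of \<open>H\<close>. Exchanging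
  \<open>c\<close> with \<open>d\<close> and \<open>\<beta>\<close> with \<open>\<gamma>\<close> turns the relations for \<open>(\<phi>, \<psi>)\<close> into those for
  \<open>(\<beta> \<gamma> \<psi>, \<phi>)\<close>, so statements about \<open>\<phi>\<close> and \<open>\<psi>\<close> imply each other. For solvability, the operators
  \<open>L\<^sub>a\<^sub>d\<^sub>(\<^sub>c\<^sub>)\<close> and \<open>L\<^sub>b\<^sub>d\<^sub>(\<^sub>c\<^sub>)\<close> annihilate \<open>u\<^sub>c\<close>; taking \<open>u\<^sub>c\<close> as a coordinate in place of \<open>z\<^sub>d\<close> makes them
  multiples of two coordinate derivatives, and the relations become a closed system that the
  Poincare lemma solves.
\<close>

section \<open>Holomorphic functions of several variables\<close>

lemma holo_subset: "holo f S \<Longrightarrow> T \<subseteq> S \<Longrightarrow> holo f T"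
  by (auto simp: holo_def)

text \<open>The real basis vectors of the vector type are the vectors \<open>axis i b\<close> with
  \<open>b\<close> in the basis of a component, so the inner products in the basis criterion for
  derivatives are those of the components.\<close>

lemma has_derivative_vec:
  fixes f :: "'a::real_normed_vector \<Rightarrow> 'b::euclidean_space ^ 'n"
  assumes "\<And>i. ((\<lambda>x. f x $ i) has_derivative (\<lambda>v. f' v $ i)) (at x within S)"
  shows "(f has_derivative f') (at x within S)"
proof -
  have "((\<lambda>x. f x $ i \<bullet> b) has_derivative (\<lambda>v. f' v $ i \<bullet> b)) (at x within S)" for i b
    using assms[of i] by (rule has_derivative_inner_left)
  then show ?thesis
    by (auto simp: has_derivative_componentwise_within[of f] Basis_vec_def inner_axis)
qed

lemma has_derivative_add_vector_scalar:
  fixes a v :: "complex ^ 'n"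
  shows "((\<lambda>w. a + w *s v) has_derivative (\<lambda>w. w *s v)) (at w within A)"
  by (rule has_derivative_vec) (auto intro!: derivative_eq_intros)

text \<open>Complex linearity of \<open>f'\<close> is what makes the restriction to a complex line
  differentiable in the one-variable sense. Partial derivatives, Cauchy's formula and the identity
  theorem are all reduced to one variable in this way.\<close>

lemma has_derivative_line:
  fixes f :: fn
  assumes "(f has_derivative f') (at (a + w *s v))" and lin: "\<And>c v. f' (c *s v) = c * f' v"
  shows "((\<lambda>w. f (a + w *s v)) has_field_derivative f' v) (at w)"
  using has_derivative_compose[OF has_derivative_add_vector_scalar assms(1)]
  by (simp add: has_field_derivative_def lin mult.commute[of _ "f' v"])

lemma axis_eq_vector_scalar: "axis i w = w *s axis i (1::complex)"
  by (auto simp: vec_eq_iff axis_def)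

lemma pd_eq:
  assumes "(f has_derivative f') (at z)" and "\<And>c v. f' (c *s v) = c * f' v"
  shows "pd i f z = f' (axis i 1)"
proof -
  have "(f has_derivative f') (at (z + 0 *s axis i 1))" using assms(1) by simp
  from DERIV_imp_deriv[OF has_derivative_line[OF this assms(2)]]
  show ?thesis unfolding pd_def by (subst axis_eq_vector_scalar)
qed

text \<open>A derivative in coordinate form is automatically complex linear, so one such fact yields
  both holomorphy at \<open>z\<close> and the values of all \<open>pd i f z\<close>. The calculus
  rules are proved in this form.\<close>

definition has_gradient :: "fn \<Rightarrow> (4 \<Rightarrow> complex) \<Rightarrow> complex ^ 4 \<Rightarrow> bool" where
  "has_gradient f c z \<longleftrightarrow> (f has_derivative (\<lambda>v. \<Sum>i\<in>UNIV. c i * v $ i)) (at z)"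

lemma
  assumes "has_gradient f c z"
  shows holo_gradient: "holo f {z}" and pd_gradient: "pd i f z = c i"
proof -
  have lin: "(\<Sum>i\<in>UNIV. c i * (k *s v) $ i) = k * (\<Sum>i\<in>UNIV. c i * v $ i)" for k v
    by (simp add: sum_distrib_left mult.left_commute)
  note der = assms[unfolded has_gradient_def]
  show "holo f {z}"
    unfolding holo_def using der lin by blast
  have "c k * axis i 1 $ k = (if k = i then c k else 0)" for k
    by (simp add: axis_def)
  then show "pd i f z = c i"
    using pd_eq[OF der lin, of i] by simp
qed

text \<open>Expand \<open>v\<close> in the basis vectors \<open>axis i 1\<close>; complex linearity
  takes the coordinates out, and the value of \<open>f'\<close> at a basis vector is a partial
  derivative.\<close>

lemma holo_has_gradient:
  assumes "holo f S" "z \<in> S"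
  shows "has_gradient f (\<lambda>i. pd i f z) z"
proof -
  obtain f' where f': "(f has_derivative f') (at z)" and lin: "\<And>c v. f' (c *s v) = c * f' v"
    using assms unfolding holo_def by blast
  have "f' v = (\<Sum>i\<in>UNIV. pd i f z * v $ i)" for v
  proof -
    interpret bounded_linear f' using f' by (rule has_derivative_bounded_linear)
    have "v = (\<Sum>i\<in>UNIV. v $ i *s axis i 1)"
      by (simp add: basis_expansion)
    then have "f' v = (\<Sum>i\<in>UNIV. f' (v $ i *s axis i 1))"
      by (metis sum)
    then show ?thesis
      by (simp add: lin pd_eq[OF f' lin] mult.commute)
  qed
  then show ?thesis using f' unfolding has_gradient_def by presburger
qed

text \<open>\<open>holo\<close> takes derivatives in the whole space and not within the set, so
  \<open>holo f {z}\<close> means complex differentiability at \<open>z\<close>. The calculus rules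
  are stated at single points and extended to sets by this equivalence.\<close>

lemma holo_iff_singletons: "holo f S \<longleftrightarrow> (\<forall>z\<in>S. holo f {z})"
  by (auto simp: holo_def)

lemmas holo_has_derivative = holo_has_gradient[unfolded has_gradient_def]

lemma holo_imp_continuous_on: "holo f S \<Longrightarrow> continuous_on S f"
  unfolding holo_def
  by (metis continuous_at_imp_continuous_on has_derivative_continuous)

section \<open>Rules of differentiation\<close>

lemma
  shows holo_const: "holo (\<lambda>z. c) S" and pd_const: "pd i (\<lambda>z. c) z = 0"
proof -
  have *: "has_gradient (\<lambda>z::complex^4. c) (\<lambda>i. 0) z" for z
    unfolding has_gradient_def
    by simp
  show "holo (\<lambda>z. c) S" using holo_gradient[OF *] holo_iff_singletons by blast
  show "pd i (\<lambda>z. c) z = 0" using * by (rule pd_gradient)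
qed

lemma
  shows holo_component: "holo (\<lambda>z. z $ j) S"
    and pd_component: "pd i (\<lambda>z. z $ j) z = (if i = j then 1 else 0)"
proof -
  have "(if i = j then 1 else 0) * (v::complex^4) $ i = (if i = j then v $ i else 0)" for i v
    by simp
  then have *: "has_gradient (\<lambda>z::complex^4. z $ j) (\<lambda>i. (if i = j then 1 else 0)) z" for z
    unfolding has_gradient_def
    by (simp only: sum.delta' sum.delta finite UNIV_I if_True)
      (simp add: bounded_linear_imp_has_derivative bounded_linear_vec_nth)
  show "holo (\<lambda>z. z $ j) S" using holo_gradient[OF *] holo_iff_singletons by blast
  show "pd i (\<lambda>z. z $ j) z = (if i = j then 1 else 0)" using * by (rule pd_gradient)
qed

lemma
  assumes "holo f {z}" "holo g {z}"
  shows holo_add_at: "holo (\<lambda>z. f z + g z) {z}"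
    and pd_add: "pd i (\<lambda>z. f z + g z) z = pd i f z + pd i g z"
proof -
  have *: "has_gradient (\<lambda>z. f z + g z) (\<lambda>i. (pd i f z + pd i g z)) z"
    unfolding has_gradient_def using has_derivative_add[OF assms[THEN holo_has_derivative, OF singletonI]]
    by (simp add: sum.distrib algebra_simps)
  show "holo (\<lambda>z. f z + g z) {z}" using * by (rule holo_gradient)
  show "pd i (\<lambda>z. f z + g z) z = pd i f z + pd i g z" using * by (rule pd_gradient)
qed

lemma
  assumes "holo f {z}" "holo g {z}"
  shows holo_mult_at: "holo (\<lambda>z. f z * g z) {z}"
    and pd_mult: "pd i (\<lambda>z. f z * g z) z = f z * pd i g z + pd i f z * g z"
proof -
  have *: "has_gradient (\<lambda>z. f z * g z) (\<lambda>i. (f z * pd i g z + pd i f z * g z)) z"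
    unfolding has_gradient_def using has_derivative_mult[OF assms[THEN holo_has_derivative, OF singletonI]]
    by (simp add: sum.distrib sum_distrib_left sum_distrib_right algebra_simps)
  show "holo (\<lambda>z. f z * g z) {z}" using * by (rule holo_gradient)
  show "pd i (\<lambda>z. f z * g z) z = f z * pd i g z + pd i f z * g z" using * by (rule pd_gradient)
qed

lemma
  assumes "holo f {z}"
  shows holo_minus_at: "holo (\<lambda>z. - f z) {z}"
    and pd_minus: "pd i (\<lambda>z. - f z) z = - pd i f z"
  using holo_mult_at[OF holo_const[of "-1"] assms] pd_mult[OF holo_const[of "-1"] assms, of i]
  by (simp_all add: pd_const)

lemma
  assumes "holo f {z}" "holo g {z}"
  shows holo_diff_at: "holo (\<lambda>z. f z - g z) {z}"
    and pd_diff: "pd i (\<lambda>z. f z - g z) z = pd i f z - pd i g z"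
  using holo_add_at[OF assms(1) holo_minus_at[OF assms(2)]]
    pd_add[OF assms(1) holo_minus_at[OF assms(2)], of i] pd_minus[OF assms(2), of i]
  by simp_all

lemma
  assumes "holo f {z}" "f z \<noteq> 0"
  shows holo_inverse_at: "holo (\<lambda>z. inverse (f z)) {z}"
    and pd_inverse: "pd i (\<lambda>z. inverse (f z)) z = - inverse (f z) * pd i f z * inverse (f z)"
proof -
  have *: "has_gradient (\<lambda>z. inverse (f z)) (\<lambda>i. (- inverse (f z) * pd i f z * inverse (f z))) z"
    unfolding has_gradient_def using Deriv.has_derivative_inverse[OF assms(2) assms(1)[THEN holo_has_derivative, OF singletonI]]
    by (simp add: sum_negf sum_distrib_left sum_distrib_right mult.assoc mult.commute[of "_ $ _"])
  show "holo (\<lambda>z. inverse (f z)) {z}" using * by (rule holo_gradient)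
  show "pd i (\<lambda>z. inverse (f z)) z = - inverse (f z) * pd i f z * inverse (f z)"
    using * by (rule pd_gradient)
qed

lemma
  assumes "holo f {z}" "holo g {z}" "g z \<noteq> 0"
  shows holo_divide_at: "holo (\<lambda>z. f z / g z) {z}"
    and pd_divide: "pd i (\<lambda>z. f z / g z) z = (g z * pd i f z - f z * pd i g z) / (g z)\<^sup>2"
  using holo_mult_at[OF assms(1) holo_inverse_at[OF assms(2,3)]]
    pd_mult[OF assms(1) holo_inverse_at[OF assms(2,3)], of i] pd_inverse[OF assms(2,3), of i] assms(3)
  by (simp_all add: field_simps power2_eq_square)

lemma
  assumes f: "holo f S" "g z \<in> S" and g: "\<And>j. holo (\<lambda>z. g z $ j) {z}"
  shows holo_compose_at: "holo (\<lambda>z. f (g z)) {z}"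
    and pd_compose: "pd i (\<lambda>z. f (g z)) z = (\<Sum>j\<in>UNIV. pd j f (g z) * pd i (\<lambda>z. g z $ j) z)"
proof -
  have "(g has_derivative (\<lambda>v. \<chi> j. \<Sum>i\<in>UNIV. pd i (\<lambda>z. g z $ j) z * v $ i)) (at z)"
    by (rule has_derivative_vec) (simp add: holo_has_derivative[OF g singletonI])
  from has_derivative_compose[OF this holo_has_derivative[OF f]]
  have "((\<lambda>z. f (g z)) has_derivative
      (\<lambda>v. \<Sum>j\<in>UNIV. \<Sum>i\<in>UNIV. pd j f (g z) * (pd i (\<lambda>z. g z $ j) z * v $ i))) (at z)"
    by (simp add: sum_distrib_left)
  moreover have "(\<Sum>j\<in>UNIV. \<Sum>i\<in>UNIV. pd j f (g z) * (pd i (\<lambda>z. g z $ j) z * v $ i))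
      = (\<Sum>i\<in>UNIV. (\<Sum>j\<in>UNIV. pd j f (g z) * pd i (\<lambda>z. g z $ j) z) * v $ i)" for v :: "complex^4"
    by (subst sum.swap) (simp add: sum_distrib_right mult.assoc)
  ultimately have *: "has_gradient (\<lambda>z. f (g z)) (\<lambda>i. (\<Sum>j\<in>UNIV. pd j f (g z) * pd i (\<lambda>z. g z $ j) z)) z"
    unfolding has_gradient_def by (simp only:)
  show "holo (\<lambda>z. f (g z)) {z}" using * by (rule holo_gradient)
  show "pd i (\<lambda>z. f (g z)) z = (\<Sum>j\<in>UNIV. pd j f (g z) * pd i (\<lambda>z. g z $ j) z)"
    using * by (rule pd_gradient)
qed

section \<open>Partial derivatives depend only on values near the point\<close>

lemma continuous_axis: "continuous_on A (\<lambda>w. z + axis i w :: complex ^ 'n)"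
  by (subst axis_eq_vector_scalar)
    (rule has_derivative_continuous_on[OF has_derivative_add_vector_scalar])

lemma eventually_nhds_line:
  fixes z :: "complex ^ 4"
  assumes "open S" "z \<in> S"
  shows "\<forall>\<^sub>F w in nhds 0. z + axis i w \<in> S"
proof -
  have "open ((\<lambda>w. z + axis i w) -` S)"
    using continuous_axis[of UNIV z i] assms(1) by (simp add: continuous_on_open_vimage)
  moreover have "z + axis i 0 = z"
    by (simp add: vec_eq_iff axis_def)
  then have "(0::complex) \<in> (\<lambda>w. z + axis i w) -` S"
    using assms(2) by (simp only: vimage_eq)
  ultimately show ?thesis unfolding eventually_nhds by blast
qed

lemma pd_cong:
  assumes "open S" "z \<in> S" "\<And>z. z \<in> S \<Longrightarrow> f z = g z"
  shows "pd i f z = pd i g z"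
  unfolding pd_def
  by (rule deriv_cong_ev[OF eventually_mono[OF eventually_nhds_line[OF assms(1,2)] assms(3)] refl])

lemma holo_cong_at:
  assumes "open S" "z \<in> S" "\<And>z. z \<in> S \<Longrightarrow> f z = g z" "holo f {z}"
  shows "holo g {z}"
proof -
  have "has_gradient g (\<lambda>i. pd i f z) z"
    unfolding has_gradient_def
    by (rule has_derivative_transform_within_open[OF holo_has_derivative[OF assms(4) singletonI] assms(1,2,3)])
  then show ?thesis by (rule holo_gradient)
qed

section \<open>Cauchy's formula and higher derivatives\<close>

text \<open>Differentiation under the integral sign: Leibniz's rule for a continuous family of
  bounded linear maps, read off in coordinates.\<close>

lemma
  fixes g :: "complex ^ 4 \<Rightarrow> real \<Rightarrow> complex"
  assumes S: "open S" "z \<in> S" and g: "\<And>t. t \<in> {a..b} \<Longrightarrow> holo (\<lambda>z. g z t) S"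
    and int: "\<And>z. z \<in> S \<Longrightarrow> g z integrable_on {a..b}"
    and cont: "\<And>i. continuous_on (S \<times> {a..b}) (\<lambda>(z, t). pd i (\<lambda>z. g z t) z)"
  shows holo_integral_at: "holo (\<lambda>z. integral {a..b} (g z)) {z}"
    and pd_integral: "pd i (\<lambda>z. integral {a..b} (g z)) z = integral {a..b} (\<lambda>t. pd i (\<lambda>z. g z t) z)"
proof -
  obtain e where e: "e > 0" "ball z e \<subseteq> S"
    using S openE by blast
  let ?p = "\<lambda>i. Blinfun (\<lambda>v::complex^4. v $ i)"
  \<comment> \<open>The derivative of the integrand in \<open>z\<close>, assembled from its partial
    derivatives and the coordinate projections as a bounded linear map, so that continuity of the
    partial derivatives gives continuity in the operator norm.\<close>
  define D where "D = (\<lambda>z t. \<Sum>i\<in>UNIV. blinfun_mult_right (pd i (\<lambda>z. g z t) z) o\<^sub>L ?p i)"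
  have p: "blinfun_apply (?p i) v = v $ i" for i v
    by (simp add: bounded_linear_Blinfun_apply bounded_linear_vec_nth)
  have D: "blinfun_apply (D z t) = (\<lambda>v. \<Sum>i\<in>UNIV. pd i (\<lambda>z. g z t) z * v $ i)" for z t
    by (simp add: fun_eq_iff D_def blinfun.sum_left p)
  have contD: "continuous_on (ball z e \<times> cbox a b) (\<lambda>(z, t). D z t)"
  proof -
    have "continuous_on (ball z e \<times> {a..b}) (\<lambda>x. pd i (\<lambda>z. g z (snd x)) (fst x))" for i
      using continuous_on_subset[OF cont[of i] Sigma_mono[OF e(2) order_refl]]
      by (simp add: case_prod_unfold)
    then show ?thesis
      unfolding D_def case_prod_beta cbox_interval
      by (intro continuous_intros)
  qed
  have der: "((\<lambda>z. integral (cbox a b) (g z)) has_derivative integral (cbox a b) (D z)) (at z within ball z e)"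
  proof (rule leibniz_rule[OF _ _ contD])
    show "((\<lambda>z. g z t) has_derivative D y t) (at y within ball z e)"
      if "y \<in> ball z e" "t \<in> cbox a b" for y t
    proof -
      have "t \<in> {a..b}" "y \<in> S" using that e(2) by auto
      from holo_has_derivative[OF g[OF this(1)] this(2)] show ?thesis
        unfolding D by (rule has_derivative_at_withinI)
    qed
    show "g y integrable_on cbox a b" if "y \<in> ball z e" for y
      using int[of y] that e(2) by (simp add: cbox_interval subset_eq)
  qed (use e(1) in simp_all)
  have intD: "D z integrable_on cbox a b"
  proof (rule integrable_continuous)
    show "continuous_on (cbox a b) (D z)"
    proof -
      have "continuous_on (cbox a b) (\<lambda>t. case (z, t) of (z, t) \<Rightarrow> D z t)"
        by (rule continuous_on_compose2[OF contD]) (use e(1) in \<open>auto intro!: continuous_intros\<close>)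
      then show ?thesis by (simp only: prod.case)
    qed
  qed
  have intpd: "(\<lambda>t. pd i (\<lambda>z. g z t) z) integrable_on {a..b}" for i
  proof (rule integrable_continuous_interval)
    have "continuous_on {a..b} (\<lambda>t. case (z, t) of (z, t) \<Rightarrow> pd i (\<lambda>z. g z t) z)"
      by (rule continuous_on_compose2[OF cont[of i]]) (use S in \<open>auto intro!: continuous_intros\<close>)
    then show "continuous_on {a..b} (\<lambda>t. pd i (\<lambda>z. g z t) z)" by (simp only: prod.case)
  qed
  \<comment> \<open>Evaluation at \<open>v\<close> commutes with the integral, so the integrated map
    has the integrated partial derivatives as its coefficients.\<close>
  have "blinfun_apply (integral (cbox a b) (D z))
      = (\<lambda>v. \<Sum>i\<in>UNIV. integral {a..b} (\<lambda>t. pd i (\<lambda>z. g z t) z) * v $ i)"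
  proof
    fix v
    have "blinfun_apply (integral (cbox a b) (D z)) v = integral {a..b} (\<lambda>t. D z t v)"
      using blinfun_apply_integral[OF intD] by (simp add: cbox_interval)
    also have "\<dots> = (\<Sum>i\<in>UNIV. integral {a..b} (\<lambda>t. pd i (\<lambda>z. g z t) z * v $ i))"
      unfolding D by (intro integral_sum integrable_on_mult_left intpd) simp
    finally show "blinfun_apply (integral (cbox a b) (D z)) v
      = (\<Sum>i\<in>UNIV. integral {a..b} (\<lambda>t. pd i (\<lambda>z. g z t) z) * v $ i)" by simp
  qed
  moreover have "at z within ball z e = at z"
    using e(1) by (intro at_within_open) auto
  ultimately have *: "has_gradient (\<lambda>z. integral {a..b} (g z)) (\<lambda>i. integral {a..b} (\<lambda>t. pd i (\<lambda>z. g z t) z)) z"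
    using der unfolding has_gradient_def by (simp only: cbox_interval)
  show "holo (\<lambda>z. integral {a..b} (g z)) {z}" using * by (rule holo_gradient)
  show "pd i (\<lambda>z. integral {a..b} (g z)) z = integral {a..b} (\<lambda>t. pd i (\<lambda>z. g z t) z)"
    using * by (rule pd_gradient)
qed

lemma
  assumes "holo f S" "z + a \<in> S"
  shows holo_translate: "holo (\<lambda>z. f (z + a)) {z}" and pd_translate: "pd i (\<lambda>z. f (z + a)) z = pd i f (z + a)"
proof -
  have j: "holo (\<lambda>z. (z + a) $ j) {z}" "pd i (\<lambda>z. (z + a) $ j) z = (if i = j then 1 else 0)" for j
    unfolding vector_add_component
    by (auto intro!: holo_add_at holo_component holo_const
        simp: pd_add[OF holo_component holo_const] pd_component pd_const)
  show "holo (\<lambda>z. f (z + a)) {z}"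
    using holo_compose_at[OF assms(1), of "\<lambda>z. z + a"] assms(2) j by blast
  show "pd i (\<lambda>z. f (z + a)) z = pd i f (z + a)"
  proof -
    have "pd k f (z + a) * (if i = k then 1 else 0) = (if i = k then pd k f (z + a) else 0)" for k
      by simp
    then show ?thesis
      using pd_compose[OF assms(1), of "\<lambda>z. z + a" z i] assms(2) j
      by (simp del: vector_add_component)
  qed
qed

text \<open>Cauchy's formula for the first derivative on a circle in the \<open>i\<close>-th
  coordinate line. With \<open>w = r * cis (2 * pi * t)\<close>, the form
  \<open>dw / (2 * pi * \<i> * w^2)\<close> becomes \<open>cis (- 2 * pi * t) / r\<close> times
  \<open>dt\<close>; as an integral over a fixed real interval it can be differentiated in
  \<open>z\<close>.\<close>

lemma pd_Cauchy:
  assumes "holo f S" "0 < r" "\<And>w. norm w \<le> r \<Longrightarrow> z + axis i w \<in> S"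
  shows "pd i f z = integral {0..1} (\<lambda>t. f (z + axis i (r * cis (2 * pi * t))) * (cis (- 2 * pi * t) / r))"
proof -
  have der: "((\<lambda>w. f (z + axis i w)) has_field_derivative pd i f (z + axis i w)) (at w)"
    if "norm w \<le> r" for w
  proof -
    note z = holo_has_gradient[OF assms(1) assms(3)[OF that]]
    have lin: "(\<Sum>j\<in>UNIV. pd j f (z + axis i w) * (k *s v) $ j)
        = k * (\<Sum>j\<in>UNIV. pd j f (z + axis i w) * v $ j)" for k v
      by (simp add: sum_distrib_left mult.left_commute)
    have "((\<lambda>w. f (z + w *s axis i 1)) has_field_derivative
        (\<Sum>j\<in>UNIV. pd j f (z + axis i w) * axis i 1 $ j)) (at w)"
      using z by (intro has_derivative_line[OF _ lin])
        (simp add: has_gradient_def axis_eq_vector_scalar[of i w])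
    moreover have "pd j f (z + axis i w) * axis i 1 $ j = (if j = i then pd j f (z + axis i w) else 0)" for j
      by (simp add: axis_def)
    ultimately show ?thesis
      by (simp add: axis_eq_vector_scalar[of i, symmetric])
  qed
  have c: "continuous_on (cball 0 r) (\<lambda>w. f (z + axis i w))"
    using der by (auto intro!: DERIV_continuous_on[OF has_field_derivative_at_within])
  have h: "(\<lambda>w. f (z + axis i w)) holomorphic_on ball 0 r"
    unfolding holomorphic_on_open[OF open_ball]
  proof
    fix x :: complex assume "x \<in> ball 0 r"
    then have "norm x \<le> r" by simp
    from der[OF this] show "\<exists>f'. ((\<lambda>w. f (z + axis i w)) has_field_derivative f') (at x)" ..
  qed
  have "pd i f z = 1 / (2 * of_real pi * \<i>) * contour_integral (circlepath 0 r) (\<lambda>u. f (z + axis i u) / (u - 0)\<^sup>2)"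
    unfolding pd_def
    by (rule DERIV_imp_deriv[OF Cauchy_derivative_integral_circlepath(2)[OF c h]]) (use assms(2) in auto)
  also have "\<dots> = integral {0..1} (\<lambda>t. 1 / (2 * of_real pi * \<i>) *
      (f (z + axis i (circlepath 0 r t)) / (circlepath 0 r t - 0)\<^sup>2 * vector_derivative (circlepath 0 r) (at t)))"
    unfolding contour_integral_integral by (rule integral_mult_right[symmetric])
  also have "\<dots> = integral {0..1} (\<lambda>t. f (z + axis i (r * cis (2 * pi * t))) * (cis (- 2 * pi * t) / r))"
  proof (rule integral_cong)
    fix t :: real
    define c where "c = cis (2 * pi * t)"
    have c: "c \<noteq> 0" "cis (- 2 * pi * t) = inverse c"
      by (simp_all add: c_def)
    have e: "exp (2 * of_real pi * \<i> * of_real t) = c"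
      by (simp add: c_def cis_conv_exp mult_ac)
    have "circlepath 0 r t = r * c" "vector_derivative (circlepath 0 r) (at t) = 2 * of_real pi * \<i> * r * c"
      unfolding vector_derivative_circlepath by (simp_all add: circlepath e)
    then show "1 / (2 * of_real pi * \<i>) * (f (z + axis i (circlepath 0 r t)) / (circlepath 0 r t - 0)\<^sup>2 *
        vector_derivative (circlepath 0 r) (at t))
      = f (z + axis i (r * cis (2 * pi * t))) * (cis (- 2 * pi * t) / r)"
      unfolding c(2) c_def[symmetric] using assms(2) c(1)
      by (simp add: divide_simps power2_eq_square)
  qed
  finally show ?thesis .
qed

lemma norm_axis_complex: "norm (axis i (w::complex) :: complex ^ 'n) = norm w"
proof -
  have "(norm ((axis i w :: complex ^ 'n) $ j))\<^sup>2 = (if j = i then (norm w)\<^sup>2 else 0)" for j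
    by (simp add: axis_def)
  then show ?thesis by (simp add: norm_vec_def L2_set_def)
qed

text \<open>The doubled radius leaves room for a circle of the same radius \<open>r\<close> around
  every point of \<open>ball z0 r\<close>, so one contour serves for all points near
  \<open>z0\<close>.\<close>

lemma Cauchy_translation:
  fixes S :: "(complex ^ 4) set"
  assumes "cball z0 (2 * r) \<subseteq> S" "z \<in> ball z0 r" "norm w \<le> r"
  shows "z + axis i w \<in> S"
proof -
  have "dist z0 (z + axis i w) \<le> dist z0 z + norm (axis i w :: complex^4)"
    using dist_triangle[of z0 "z + axis i w" z] by (simp add: dist_norm)
  also have "\<dots> \<le> 2 * r" using assms(2,3) by (simp add: norm_axis_complex)
  finally show ?thesis using assms(1) by auto
qed

lemma continuous_on_Cauchy_integrand:
  fixes f :: fn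
  assumes f: "continuous_on S f" and r: "0 < r" "cball z0 (2 * r) \<subseteq> S"
  shows "continuous_on (ball z0 r \<times> {0..1})
    (\<lambda>(z, t). f (z + axis i (r * cis (2 * pi * t))) * (cis (- 2 * pi * t) / r))"
proof -
  have "continuous_on (ball z0 r \<times> {0..1}) (\<lambda>x. axis i (r * cis (2 * pi * snd x)) :: complex ^ 4)"
  proof -
    have "continuous_on A (\<lambda>x. complex_of_real r * cis (2 * pi * snd x))" for A :: "((complex ^ 4) \<times> real) set"
      unfolding cis_conv_exp by (intro continuous_intros)
    from continuous_on_compose2[OF continuous_axis[of UNIV 0 i] this] show ?thesis by simp
  qed
  then show ?thesis
    unfolding case_prod_unfold cis_conv_exp
    using r Cauchy_translation[OF r(2)]
    by (intro continuous_intros continuous_on_compose2[OF f])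
      (auto simp: norm_mult cis_conv_exp[symmetric])
qed

lemma pd_Cauchy_ball:
  assumes "holo f S" "0 < r" "cball z0 (2 * r) \<subseteq> S" "z \<in> ball z0 r"
  shows "pd i f z = integral {0..1} (\<lambda>t. f (z + axis i (r * cis (2 * pi * t))) * (cis (- 2 * pi * t) / r))"
  using assms Cauchy_translation[OF assms(3,4)] by (intro pd_Cauchy) auto

lemma open_double_cball:
  fixes S :: "'a::metric_space set"
  assumes "open S" "z \<in> S"
  obtains r where "0 < r" "cball z (2 * r) \<subseteq> S"
proof -
  obtain e where "e > 0" "cball z e \<subseteq> S" using assms open_contains_cball by blast
  then show ?thesis using that[of "e / 2"] by simp
qed

text \<open>By Cauchy's formula, \<open>pd i f\<close> is locally an integral over a compact
  interval whose integrand is jointly continuous in the point and the parameter.\<close>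

lemma continuous_on_pd:
  assumes "open S" "holo f S"
  shows "continuous_on S (pd i f)"
proof -
  have "isCont (pd i f) z" if z: "z \<in> S" for z
  proof -
    obtain r where r: "0 < r" "cball z (2 * r) \<subseteq> S" using open_double_cball[OF assms(1) z] .
    have "continuous_on (ball z r) (\<lambda>z. integral (cbox 0 1)
        (\<lambda>t. f (z + axis i (r * cis (2 * pi * t))) * (cis (- 2 * pi * t) / r)))"
      using continuous_on_Cauchy_integrand[OF holo_imp_continuous_on[OF assms(2)] r]
      by (intro integral_continuous_on_param) (simp add: cbox_interval)
    then have "continuous_on (ball z r) (pd i f)"
      by (rule continuous_on_eq) (simp only: pd_Cauchy_ball[OF assms(2) r] cbox_interval)
    then show ?thesis using r(1) by (simp add: continuous_on_eq_continuous_at)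
  qed
  then show ?thesis by (simp add: continuous_at_imp_continuous_on)
qed

text \<open>Differentiate Cauchy's formula for \<open>pd i f\<close> under the integral. The new
  derivative falls on \<open>f\<close> inside the integral, while the circle stays in direction
  \<open>i\<close>.\<close>

lemma
  assumes S: "open S" "z \<in> S" and f: "holo f S"
  shows holo_pd_at: "holo (pd i f) {z}"
    and pd_pd_integral: "\<exists>r>0. cball z (2 * r) \<subseteq> S \<and> pd j (pd i f) z =
      integral {0..1} (\<lambda>t. pd j f (z + axis i (r * cis (2 * pi * t))) * (cis (- 2 * pi * t) / r))"
proof -
  obtain r where r: "0 < r" "cball z (2 * r) \<subseteq> S" using open_double_cball[OF S] .
  define a :: "real \<Rightarrow> complex ^ 4" where "a = (\<lambda>t. axis i (r * cis (2 * pi * t)))"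
  define k where "k = (\<lambda>t. cis (- 2 * pi * t) / complex_of_real r)"
  let ?g = "\<lambda>z t. f (z + a t) * k t"
  have in_S: "y + a t \<in> S" if "y \<in> ball z r" for y t
    using Cauchy_translation[OF r(2) that] r(1) by (simp add: a_def norm_mult)
  have z: "z \<in> ball z r" using r(1) by simp
  have g: "holo (\<lambda>z. ?g z t) {y}" "pd j (\<lambda>z. ?g z t) y = pd j f (y + a t) * k t" if "y \<in> ball z r" for y t j
    using holo_translate[OF f in_S[OF that]] pd_translate[OF f in_S[OF that]]
    by (auto intro!: holo_mult_at holo_const simp: pd_mult[OF _ holo_const] pd_const)
  have holo: "holo (\<lambda>z. ?g z t) (ball z r)" for t
    using g(1) holo_iff_singletons[of _ "ball z r"] by blast
  have int: "?g y integrable_on {0..1}" if "y \<in> ball z r" for y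
  proof (rule integrable_continuous_interval)
    have "continuous_on {0..1} (\<lambda>t. case (y, t) of (z, t) \<Rightarrow> ?g z t)"
      unfolding a_def k_def
      by (rule continuous_on_compose2[OF continuous_on_Cauchy_integrand[OF holo_imp_continuous_on[OF f] r]])
        (use that in \<open>auto intro!: continuous_intros\<close>)
    then show "continuous_on {0..1} (?g y)" by (simp only: prod.case)
  qed
  have cont: "continuous_on (ball z r \<times> {0..1}) (\<lambda>(y, t). pd j (\<lambda>z. ?g z t) y)" for j
  proof -
    have "continuous_on (ball z r \<times> {0..1}) (\<lambda>(y, t). pd j f (y + a t) * k t)"
      using continuous_on_Cauchy_integrand[OF continuous_on_pd[OF S(1) f] r] unfolding a_def k_def .
    then show ?thesis
      by (rule continuous_on_eq) (auto simp: g(2))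
  qed
  have eq: "pd i f y = integral {0..1} (?g y)" if "y \<in> ball z r" for y
    using pd_Cauchy_ball[OF f r that] unfolding a_def k_def .
  note par = holo_integral_at[OF open_ball z holo int cont] pd_integral[OF open_ball z holo int cont]
  show "holo (pd i f) {z}"
    by (rule holo_cong_at[OF open_ball z eq[symmetric] par(1)])
  have "pd j (pd i f) z = integral {0..1} (\<lambda>t. pd j f (z + a t) * k t)"
    using pd_cong[OF open_ball z eq] par(2) g(2)[OF z] by simp
  then show "\<exists>r>0. cball z (2 * r) \<subseteq> S \<and> pd j (pd i f) z =
      integral {0..1} (\<lambda>t. pd j f (z + axis i (r * cis (2 * pi * t))) * (cis (- 2 * pi * t) / r))"
    using r unfolding a_def k_def by blast
qed

lemma holo_pd: "open S \<Longrightarrow> holo f S \<Longrightarrow> holo (pd i f) S"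
  by (subst holo_iff_singletons) (blast intro: holo_pd_at)

text \<open>Differentiating Cauchy's formula for \<open>pd j f\<close> in direction \<open>i\<close>
  gives an integral that is itself Cauchy's formula for \<open>pd j\<close> applied to
  \<open>pd i f\<close>.\<close>

lemma pd_commute:
  assumes "open S" "holo f S" "z \<in> S"
  shows "pd i (pd j f) z = pd j (pd i f) z"
proof -
  obtain r where r: "0 < r" "cball z (2 * r) \<subseteq> S" "pd i (pd j f) z =
      integral {0..1} (\<lambda>t. pd i f (z + axis j (r * cis (2 * pi * t))) * (cis (- 2 * pi * t) / r))"
    using pd_pd_integral[OF assms(1,3,2)] by blast
  then show ?thesis
    using pd_Cauchy_ball[OF holo_pd[OF assms(1,2)] r(1,2), of z j i] by simp
qed

text \<open>The points near which \<open>f\<close> vanishes form an open set whose complement in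
  \<open>S\<close> is open too. The second claim comes from the one-variable identity theorem on
  complex lines inside balls; connectedness of \<open>S\<close> finishes the proof.\<close>

lemma holo_eq_0_continuation:
  assumes S: "open S" "connected S" and f: "holo f S"
    and T: "open T" "T \<noteq> {}" "T \<subseteq> S" "\<And>z. z \<in> T \<Longrightarrow> f z = 0"
    and z: "z \<in> S"
  shows "f z = 0"
proof -
  have ball: "f y = 0" if b: "ball c e \<subseteq> S" "w \<in> ball c e" "open W" "w \<in> W" "\<And>z. z \<in> W \<Longrightarrow> f z = 0" "y \<in> ball c e"
    for c e w W y
  proof -
    \<comment> \<open>The complex line through \<open>w\<close> and \<open>y\<close>. Since
      \<open>h\<close> is affine, the preimage of the ball is convex, hence connected, and
      \<open>f\<close> composed with \<open>h\<close> vanishes near 0.\<close>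
    define h where "h = (\<lambda>t. w + t *s (y - w))"
    have h: "continuous_on A h" for A
      unfolding h_def by (rule has_derivative_continuous_on[OF has_derivative_add_vector_scalar])
    have real: "h (of_real t) = (1 - t) *\<^sub>R w + t *\<^sub>R y" for t :: real
    proof -
      have "a + of_real t * (b - a) = (1 - of_real t) * a + of_real t * b" for a b :: complex
        by algebra
      then show ?thesis
        unfolding h_def vec_eq_iff
        by (simp only: vector_add_component vector_minus_component vector_smult_component
            vector_scaleR_component scaleR_conv_of_real[where 'a=complex] of_real_diff of_real_1 simp_thms)
    qed
    have op: "open (h -` V)" if "open V" for V
      using h[of UNIV] that by (simp add: continuous_on_open_vimage)
    define A where "A = h -` ball c e"
    have A: "open A" unfolding A_def by (rule op) simp
    have "h (u *\<^sub>R s + v *\<^sub>R t) = u *\<^sub>R h s + v *\<^sub>R h t" if "u + v = 1" for u v s t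
    proof -
      have "of_real u + of_real v = (1::complex)" using that by (metis of_real_1 of_real_add)
      then have "a + (of_real u * s + of_real v * t) * d = of_real u * (a + s * d) + of_real v * (a + t * d)"
        for a d :: complex by algebra
      then show ?thesis
        unfolding h_def vec_eq_iff
        by (simp only: vector_add_component vector_smult_component vector_scaleR_component
            scaleR_conv_of_real[where 'a=complex] simp_thms)
    qed
    then have conv: "connected A"
      unfolding A_def using convex_ball[of c e]
      by (intro convex_connected) (simp add: convex_def)
    have hol: "(\<lambda>t. f (h t)) holomorphic_on A"
      unfolding holomorphic_on_open[OF A]
    proof
      fix t assume "t \<in> A"
      then have "h t \<in> S" using b(1) by (auto simp: A_def)
      then obtain f' where f': "(f has_derivative f') (at (w + t *s (y - w)))" "\<And>c v. f' (c *s v) = c * f' v"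
        using f unfolding holo_def h_def by blast
      show "\<exists>f'. ((\<lambda>t. f (h t)) has_field_derivative f') (at t)"
        unfolding h_def by (rule exI, rule has_derivative_line[OF f'])
    qed
    have h01: "h 0 = w" "h 1 = y" using real[of 0] real[of 1] by simp_all
    have "0 \<in> A \<inter> h -` W" and 1: "1 \<in> A"
      using b(2,4,6) by (simp_all add: A_def h01)
    then have ne: "A \<inter> h -` W \<noteq> {}" by blast
    have zero: "f (h t) = 0" if "t \<in> A \<inter> h -` W" for t
      using b(5) that by blast
    have "f (h 1) = 0"
      by (rule analytic_continuation_open[OF open_Int[OF A op[OF b(3)]] A ne conv Int_lower1 hol
            holomorphic_on_const[of 0] zero 1])
    then show ?thesis by (simp only: h01)
  qed
  define Z where "Z = {z\<in>S. \<exists>W. open W \<and> z \<in> W \<and> (\<forall>z\<in>W. f z = 0)}"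
  have "open Z"
  proof -
    have "Z = S \<inter> \<Union>{W. open W \<and> (\<forall>z\<in>W. f z = 0)}" by (auto simp: Z_def)
    moreover have "open (\<Union>{W. open W \<and> (\<forall>z\<in>W. f z = 0)})" by (rule open_Union) blast
    ultimately show ?thesis using S(1) by (simp only: open_Int)
  qed
  \<comment> \<open>If a ball in \<open>S\<close> around \<open>c\<close> met \<open>Z\<close>, then
    \<open>f\<close> would vanish on the whole ball, which puts \<open>c\<close> itself into
    \<open>Z\<close>.\<close>
  moreover have "open (S - Z)"
    unfolding open_contains_ball
  proof
    fix c assume c: "c \<in> S - Z"
    obtain e where e: "e > 0" "ball c e \<subseteq> S" using S(1) c openE by blast
    have "y \<notin> Z" if "y \<in> ball c e" for y
    proof
      assume "y \<in> Z"
      then obtain W where "open W" "y \<in> W" "\<forall>z\<in>W. f z = 0" unfolding Z_def by blast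
      then have "\<forall>z\<in>ball c e. f z = 0" using ball[OF e(2) that] by blast
      moreover have "c \<in> ball c e" "c \<in> S" using e(1) c by simp_all
      ultimately have "c \<in> Z" unfolding Z_def using open_ball by blast
      then show False using c by blast
    qed
    then show "\<exists>e>0. ball c e \<subseteq> S - Z" using e by blast
  qed
  moreover have "Z \<inter> S \<noteq> {}" using T unfolding Z_def by blast
  ultimately have "S - Z = {}"
    using connectedD[OF S(2), of Z "S - Z"] by blast
  then have "z \<in> Z" using z by blast
  then show ?thesis unfolding Z_def by blast
qed

section \<open>Two commuting first-order equations\<close>

text \<open>The Jacobian of \<open>\<Phi>\<close> is the identity except for row \<open>k\<close>,
  which is the gradient of \<open>h\<close>, so \<open>pd k h p \<noteq> 0\<close> makes it
  invertible and the inverse function theorem applies.\<close>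

lemma straightening:
  fixes h :: fn
  assumes S: "open S" "p \<in> S" and h: "holo h S" and nz: "pd k h p \<noteq> 0"
  defines "\<Phi> \<equiv> \<lambda>z. \<chi> m. if m = k then h z else z $ m"
  obtains V W g where "open V" "p \<in> V" "V \<subseteq> S" "open W" "homeomorphism V W \<Phi> g"
    "\<And>m. holo (\<lambda>y. g y $ m) W"
proof -
  let ?p = "\<lambda>i. Blinfun (\<lambda>v::complex^4. v $ i)"
  let ?e = "Blinfun (axis k :: complex \<Rightarrow> complex ^ 4)"
  \<comment> \<open>\<open>G z\<close> is the differential of \<open>h\<close>, \<open>D z\<close>
    is the Jacobian of \<open>\<Phi>\<close> as a rank-one perturbation of the identity, and
    \<open>I\<close> is the inverse of \<open>D p\<close>, again a rank-one perturbation.\<close>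
  define G where "G = (\<lambda>z. \<Sum>i\<in>UNIV. blinfun_mult_right (pd i h z) o\<^sub>L ?p i)"
  define D where "D = (\<lambda>z. id_blinfun + (?e o\<^sub>L (G z - ?p k)))"
  define I where "I = id_blinfun + (?e o\<^sub>L (blinfun_mult_right (inverse (pd k h p)) o\<^sub>L (?p k - G p)))"
  have p: "blinfun_apply (?p i) v = v $ i" for i v
    by (simp add: bounded_linear_Blinfun_apply bounded_linear_vec_nth)
  have "bounded_linear (axis k :: complex \<Rightarrow> complex ^ 4)"
    by (auto intro!: linearI simp: linear_conv_bounded_linear[symmetric] vec_eq_iff axis_def)
  then have e: "blinfun_apply ?e w = axis k w" for w
    by (rule bounded_linear_Blinfun_apply[THEN fun_cong])
  have G: "blinfun_apply (G z) v = (\<Sum>i\<in>UNIV. pd i h z * v $ i)" for z v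
    by (simp add: G_def blinfun.sum_left p)
  have D: "blinfun_apply (D z) v = (\<chi> m. if m = k then (\<Sum>i\<in>UNIV. pd i h z * v $ i) else v $ m)" for z v
    by (simp add: D_def blinfun.add_left blinfun.diff_left G p e vec_eq_iff axis_def)
  have der: "(\<Phi> has_derivative blinfun_apply (D z)) (at z)" if "z \<in> S" for z
  proof (rule has_derivative_vec)
    fix m
    show "((\<lambda>z. \<Phi> z $ m) has_derivative (\<lambda>v. D z v $ m)) (at z)"
      using holo_has_derivative[OF h that]
      by (cases "m = k") (simp_all add: \<Phi>_def D bounded_linear_imp_has_derivative bounded_linear_vec_nth)
  qed
  have cont: "continuous_on S D"
    unfolding D_def G_def using continuous_on_pd[OF S(1) h] by (intro continuous_intros)
  have inv: "I o\<^sub>L D p = id_blinfun"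
  proof (rule blinfun_eqI)
    fix v
    let ?w = "D p v"
    have "pd i h p * ?w $ i = pd i h p * v $ i + (if i = k then pd i h p * (?w $ k - v $ k) else 0)" for i
      by (simp add: D right_diff_distrib)
    then have "(\<Sum>i\<in>UNIV. pd i h p * ?w $ i) = ?w $ k + pd k h p * (?w $ k - v $ k)"
      by (simp add: sum.distrib D)
    then have "inverse (pd k h p) * (?w $ k - (\<Sum>i\<in>UNIV. pd i h p * ?w $ i)) = v $ k - ?w $ k"
      using nz by (simp add: field_simps)
    then have "I ?w = ?w + axis k (v $ k - ?w $ k)"
      by (simp add: I_def blinfun.add_left blinfun.diff_left G p e)
    also have "\<dots> = v"
      by (simp add: vec_eq_iff axis_def D)
    finally show "(I o\<^sub>L D p) v = id_blinfun v" by simp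
  qed
  obtain V W g g' where V: "open V" "V \<subseteq> S" "p \<in> V" "open W" "\<Phi> p \<in> W" "homeomorphism V W \<Phi> g"
    and g: "\<And>y. y \<in> W \<Longrightarrow> (g has_derivative g' y) (at y)"
    and g': "\<And>y. y \<in> W \<Longrightarrow> g' y = inv (D (g y))" and bij: "\<And>y. y \<in> W \<Longrightarrow> bij (D (g y))"
    by (rule inverse_function_theorem[OF S(1) der cont S(2) inv]) blast+
  have "holo (\<lambda>y. g y $ m) W" for m
    unfolding holo_def
  proof (intro ballI exI conjI allI)
    fix y assume y: "y \<in> W"
    show "((\<lambda>y. g y $ m) has_derivative (\<lambda>v. g' y v $ m)) (at y)"
      using bounded_linear.has_derivative[OF bounded_linear_vec_nth g[OF y]] .
    fix c v
    \<comment> \<open>The inverse function theorem gives a real derivative only; it is complex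
      linear because it inverts the complex linear bijection \<open>D (g y)\<close>.\<close>
    have "D (g y) (c *s g' y v) = c *s D (g y) (g' y v)"
      by (simp add: D vec_eq_iff sum_distrib_left mult.left_commute)
    also have "D (g y) (g' y v) = v"
      using bij[OF y] g'[OF y] by (simp add: bij_is_surj surj_f_inv_f)
    finally have "g' y (c *s v) = c *s g' y v"
      using bij[OF y] g'[OF y] by (metis bij_is_inj inv_f_f)
    then show "g' y (c *s v) $ m = c * g' y v $ m" by simp
  qed
  with V show ?thesis by (intro that) auto
qed

section \<open>The Poincare lemma in two variables with parameters\<close>

definition segment_point :: "4 \<Rightarrow> 4 \<Rightarrow> complex ^ 4 \<Rightarrow> complex ^ 4 \<Rightarrow> real \<Rightarrow> complex ^ 4" where
  "segment_point i j q y s = (\<chi> m. if m = i \<or> m = j then q $ m + of_real s * (y $ m - q $ m) else y $ m)"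

text \<open>
  The primitive of \<open>A dy\<^sub>i + B dy\<^sub>j\<close> along the segment that moves only the coordinates \<open>i\<close> and \<open>j\<close>; the
  other coordinates are parameters.
\<close>

definition potential :: "4 \<Rightarrow> 4 \<Rightarrow> complex ^ 4 \<Rightarrow> fn \<Rightarrow> fn \<Rightarrow> fn" where
  "potential i j q A B y = integral {0..1} (\<lambda>s.
     (y $ i - q $ i) * A (segment_point i j q y s) + (y $ j - q $ j) * B (segment_point i j q y s))"

text \<open>Lets a statement on the derivative in direction \<open>i\<close> serve for direction
  \<open>j\<close> as well.\<close>

lemma potential_commute: "potential i j q A B = potential j i q B A"
  by (simp add: fun_eq_iff potential_def segment_point_def disj_commute add.commute)

text \<open>Each coordinate of the difference from \<open>q\<close> is either kept or shrunk by the
  factor \<open>s\<close>.\<close>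

lemma segment_point_in_ball:
  assumes "y \<in> ball q e" "s \<in> {0..1}"
  shows "segment_point i j q y s \<in> ball q e"
proof -
  have "norm ((segment_point i j q y s - q) $ m) \<le> norm ((y - q) $ m)" for m
  proof (cases "m = i \<or> m = j")
    case True
    then have "norm ((segment_point i j q y s - q) $ m) = \<bar>s\<bar> * norm ((y - q) $ m)"
      by (simp add: segment_point_def norm_mult)
    also have "\<dots> \<le> 1 * norm ((y - q) $ m)" using assms(2) by (intro mult_right_mono) auto
    finally show ?thesis by simp
  qed (simp add: segment_point_def)
  then have "norm (segment_point i j q y s - q) \<le> norm (y - q)"
    by (rule norm_le_componentwise_cart)
  then show ?thesis using assms(1) by (simp add: dist_norm norm_minus_commute)
qed

lemma
  assumes f: "holo f (ball q e)" and y: "y \<in> ball q e" "s \<in> {0..1}"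
  shows holo_segment_point: "holo (\<lambda>y. f (segment_point i j q y s)) {y}"
    and pd_segment_point: "pd m (\<lambda>y. f (segment_point i j q y s)) y =
      (if m = i \<or> m = j then of_real s else 1) * pd m f (segment_point i j q y s)"
proof -
  note b = segment_point_in_ball[OF y, of i j]
  have h: "holo (\<lambda>y. segment_point i j q y s $ l) {y}" for l
    unfolding segment_point_def
    by (cases "l = i \<or> l = j") (auto intro!: holo_add_at holo_mult_at holo_diff_at holo_const holo_component)
  have d: "pd m (\<lambda>y. segment_point i j q y s $ l) y = (if l = m then if m = i \<or> m = j then of_real s else 1 else 0)"
    for l
    unfolding segment_point_def
    by (cases "l = i \<or> l = j")
      (auto simp: pd_add pd_mult pd_diff pd_const pd_component holo_add_at holo_mult_at holo_diff_at holo_const holo_component)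
  show "holo (\<lambda>y. f (segment_point i j q y s)) {y}"
    using holo_compose_at[OF f b h] .
  have "pd l f x * (if l = m then c else 0) = (if l = m then c * pd l f x else 0)" for l x and c :: complex
    by simp
  then show "pd m (\<lambda>y. f (segment_point i j q y s)) y =
      (if m = i \<or> m = j then of_real s else 1) * pd m f (segment_point i j q y s)"
    using pd_compose[OF f b h, of m] unfolding d by simp
qed

lemma continuous_on_segment_point:
  fixes f :: fn
  assumes f: "continuous_on (ball q e) f"
  shows "continuous_on (ball q e \<times> {0..1}) (\<lambda>x. f (segment_point i j q (fst x) (snd x)))"
proof (rule continuous_on_compose2[OF f])
  have "continuous_on A (\<lambda>x. segment_point i j q (fst x) (snd x) $ m)" for m and A :: "((complex ^ 4) \<times> real) set"
    unfolding segment_point_def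
    by (cases "m = i \<or> m = j") (auto intro!: continuous_intros)
  then show "continuous_on (ball q e \<times> {0..1}) (\<lambda>x. segment_point i j q (fst x) (snd x))"
    using continuous_on_vec_lambda[of "ball q e \<times> {0..1}" "\<lambda>m x. segment_point i j q (fst x) (snd x) $ m"]
    by (simp only: vec_nth_inverse)
  show "(\<lambda>x. segment_point i j q (fst x) (snd x)) ` (ball q e \<times> {0..1}) \<subseteq> ball q e"
    using segment_point_in_ball by auto
qed

text \<open>By \<open>closed\<close>, the \<open>i\<close>-th derivative of the integrand is the
  total derivative in \<open>s\<close> of \<open>s\<close> times \<open>A\<close> along the segment,
  so its integral is the boundary value \<open>A y\<close> at \<open>s = 1\<close>.\<close>

lemma
  assumes ij: "i \<noteq> j" and A: "holo A (ball q e)" and B: "holo B (ball q e)"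
    and closed: "\<And>y. y \<in> ball q e \<Longrightarrow> pd i B y = pd j A y" and y: "y \<in> ball q e"
  shows holo_potential: "holo (potential i j q A B) {y}"
    and pd_potential: "pd i (potential i j q A B) y = A y"
proof -
  let ?x = "segment_point i j q"
  let ?g = "\<lambda>y s. (y $ i - q $ i) * A (?x y s) + (y $ j - q $ j) * B (?x y s)"
  \<comment> \<open>\<open>w\<close> is the Kronecker delta from differentiating the coordinate
    factors, and \<open>c\<close> is the chain-rule factor of the segment: \<open>s\<close> in the
    two moving directions, 1 in the parameter directions.\<close>
  define w where "w = (\<lambda>l m :: 4. if l = m then 1 else 0 :: complex)"
  define c where "c = (\<lambda>(m :: 4) s. if m = i \<or> m = j then complex_of_real s else 1)"
  have hs: "holo (\<lambda>y. ?g y s) {y}"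
    and ps: "pd m (\<lambda>y. ?g y s) y = w i m * A (?x y s) + (y $ i - q $ i) * (c m s * pd m A (?x y s))
      + (w j m * B (?x y s) + (y $ j - q $ j) * (c m s * pd m B (?x y s)))"
    if "y \<in> ball q e" "s \<in> {0..1}" for y s m
  proof -
    note 1 = holo_segment_point[OF A that, of i j] holo_segment_point[OF B that, of i j]
    have 2: "holo (\<lambda>y. y $ l - q $ l) {y}" "pd m (\<lambda>y. y $ l - q $ l) y = w l m" for l
      by (auto simp: w_def pd_diff[OF holo_component holo_const] pd_component pd_const
          intro!: holo_diff_at holo_component holo_const)
    show "holo (\<lambda>y. ?g y s) {y}"
      by (intro holo_add_at holo_mult_at 1 2)
    show "pd m (\<lambda>y. ?g y s) y = w i m * A (?x y s) + (y $ i - q $ i) * (c m s * pd m A (?x y s))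
      + (w j m * B (?x y s) + (y $ j - q $ j) * (c m s * pd m B (?x y s)))"
      by (simp add: pd_add[OF holo_mult_at[OF 2(1) 1(1)] holo_mult_at[OF 2(1) 1(2)]]
        pd_mult[OF 2(1) 1(1)] pd_mult[OF 2(1) 1(2)] 2(2) c_def
        pd_segment_point[OF A that] pd_segment_point[OF B that] add.commute)
  qed
  have contx: "continuous_on (ball q e \<times> {0..1}) (\<lambda>x. f (?x (fst x) (snd x)))" if "f \<in> {A, B, pd m A, pd m B}" for f m
    using that by (auto intro!: continuous_on_segment_point holo_imp_continuous_on A B holo_pd)
  have contc: "continuous_on X (\<lambda>x. c m (snd x))" for m and X :: "((complex ^ 4) \<times> real) set"
    unfolding c_def by (cases "m = i \<or> m = j") (auto intro!: continuous_intros)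
  have contl: "continuous_on X (\<lambda>x. fst x $ l - q $ l)" for l and X :: "((complex ^ 4) \<times> real) set"
    by (intro continuous_on_diff continuous_on_component continuous_on_fst continuous_on_id continuous_on_const)
  have hol: "holo (\<lambda>y. ?g y s) (ball q e)" if "s \<in> {0..1}" for s
    by (subst holo_iff_singletons) (use hs[OF _ that] in blast)
  have contg: "continuous_on (ball q e \<times> {0..1}) (\<lambda>(y, s). ?g y s)"
    unfolding case_prod_unfold
    by (intro continuous_on_add continuous_on_mult contl contx) auto
  have int: "?g y integrable_on {0..1}" if "y \<in> ball q e" for y
  proof (rule integrable_continuous_interval)
    have "continuous_on {0..1} (\<lambda>s. case (y, s) of (y, s) \<Rightarrow> ?g y s)"
      by (rule continuous_on_compose2[OF contg]) (use that in \<open>auto intro!: continuous_on_Pair continuous_on_const continuous_on_id\<close>)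
    then show "continuous_on {0..1} (?g y)" by (simp only: prod.case)
  qed
  have cont: "continuous_on (ball q e \<times> {0..1}) (\<lambda>(y, s). pd m (\<lambda>y. ?g y s) y)" for m
  proof (rule continuous_on_eq)
    show "continuous_on (ball q e \<times> {0..1}) (\<lambda>x.
      w i m * A (?x (fst x) (snd x)) + (fst x $ i - q $ i) * (c m (snd x) * pd m A (?x (fst x) (snd x)))
      + (w j m * B (?x (fst x) (snd x)) + (fst x $ j - q $ j) * (c m (snd x) * pd m B (?x (fst x) (snd x)))))"
      by (intro continuous_on_add continuous_on_mult contl contc contx[of _ m] continuous_on_const) auto
  qed (auto simp: ps)
  have par1: "holo (\<lambda>y. integral {0..1} (?g y)) {y}"
    by (rule holo_integral_at[of "ball q e" y 0 1 ?g, OF open_ball y hol int cont])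
  have par2: "pd i (\<lambda>y. integral {0..1} (?g y)) y = integral {0..1} (\<lambda>s. pd i (\<lambda>y. ?g y s) y)"
    by (rule pd_integral[of "ball q e" y 0 1 ?g i, OF open_ball y hol int cont])
  have pot: "potential i j q A B = (\<lambda>y. integral {0..1} (?g y))"
    by (simp add: fun_eq_iff potential_def)
  show "holo (potential i j q A B) {y}" unfolding pot by (rule par1)
  have vd: "((\<lambda>s. of_real s * A (?x y s)) has_vector_derivative pd i (\<lambda>y. ?g y s) y) (at s within {0..1})"
    if s: "s \<in> {0..1}" for s
  proof -
    define d where "d = (\<chi> m. if m = i \<or> m = j then y $ m - q $ m else 0)"
    have "(?x y has_derivative (\<lambda>t. t *\<^sub>R d)) (at s within {0..1})"
    proof (rule has_derivative_vec)
      show "((\<lambda>s. ?x y s $ m) has_derivative (\<lambda>t. (t *\<^sub>R d) $ m)) (at s within {0..1})" for m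
        by (cases "m = i \<or> m = j")
          (auto simp: segment_point_def d_def scaleR_conv_of_real[where 'a=complex] intro!: derivative_eq_intros)
    qed
    from has_derivative_compose[OF this holo_has_derivative[OF A segment_point_in_ball[OF y s]]]
    have "((\<lambda>s. A (?x y s)) has_derivative (\<lambda>t. \<Sum>m\<in>UNIV. pd m A (?x y s) * (t *\<^sub>R d) $ m)) (at s within {0..1})" .
    moreover have "(\<Sum>m\<in>UNIV. pd m A (?x y s) * (t *\<^sub>R d) $ m)
        = t *\<^sub>R (pd i A (?x y s) * (y $ i - q $ i) + pd j A (?x y s) * (y $ j - q $ j))" for t
    proof -
      have "pd m A (?x y s) * (t *\<^sub>R d) $ m = (if m = i then t *\<^sub>R (pd i A (?x y s) * (y $ i - q $ i)) else 0)
          + (if m = j then t *\<^sub>R (pd j A (?x y s) * (y $ j - q $ j)) else 0)" for m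
        using ij by (simp add: d_def)
      then show ?thesis by (simp add: sum.distrib scaleR_right_distrib)
    qed
    ultimately have "((\<lambda>s. A (?x y s)) has_vector_derivative
        (pd i A (?x y s) * (y $ i - q $ i) + pd j A (?x y s) * (y $ j - q $ j))) (at s within {0..1})"
      by (simp add: has_vector_derivative_def)
    note mult = has_vector_derivative_mult[OF has_vector_derivative_of_real[OF DERIV_ident] this]
    have "pd i (\<lambda>y. ?g y s) y = of_real s * (pd i A (?x y s) * (y $ i - q $ i) + pd j A (?x y s) * (y $ j - q $ j))
        + of_real 1 * A (?x y s)"
      unfolding ps[OF y s] closed[OF segment_point_in_ball[OF y s]] using ij
      by (simp add: w_def c_def algebra_simps)
    then show ?thesis using mult by (simp only:)
  qed
  have "((\<lambda>s. pd i (\<lambda>y. ?g y s) y) has_integral (of_real 1 * A (?x y 1) - of_real 0 * A (?x y 0))) {0..1}"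
    by (rule fundamental_theorem_of_calculus[OF _ vd]) auto
  moreover have "?x y 1 = y" by (simp add: segment_point_def vec_eq_iff)
  ultimately have "((\<lambda>s. pd i (\<lambda>y. ?g y s) y) has_integral A y) {0..1}"
    by (simp only: of_real_1 of_real_0 mult_1_left mult_zero_left diff_zero)
  then show "pd i (potential i j q A B) y = A y"
    unfolding pot par2 by (rule integral_unique)
qed

text \<open>With \<open>h\<close> as a coordinate in place of the \<open>k\<close>-th one, both
  operators on the left become \<open>pd k h\<close> times a coordinate derivative. The hypothesis
  \<open>compat\<close> then says that \<open>A dy_i + B dy_j\<close> is closed, and its potential,
  pulled back by \<open>\<Phi>\<close>, is the solution.\<close>

lemma commuting_system_solvable:
  fixes h A B :: fn
  assumes S: "open S" "p \<in> S" and ijk: "i \<noteq> j" "i \<noteq> k" "j \<noteq> k"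
    and h: "holo h S" and A: "holo A S" and B: "holo B S"
    and nz: "\<And>z. z \<in> S \<Longrightarrow> pd k h z \<noteq> 0"
    and compat: "\<And>z. z \<in> S \<Longrightarrow>
      pd k h z * pd i B z - pd i h z * pd k B z = pd k h z * pd j A z - pd j h z * pd k A z"
  shows "\<exists>V \<phi>. open V \<and> p \<in> V \<and> V \<subseteq> S \<and> holo \<phi> V \<and> (\<forall>z\<in>V.
      pd k h z * pd i \<phi> z - pd i h z * pd k \<phi> z = pd k h z * A z \<and>
      pd k h z * pd j \<phi> z - pd j h z * pd k \<phi> z = pd k h z * B z)"
proof -
  define \<Phi> :: "complex ^ 4 \<Rightarrow> complex ^ 4" where "\<Phi> = (\<lambda>z. \<chi> m. if m = k then h z else z $ m)"
  obtain V W g where VW: "open V" "p \<in> V" "V \<subseteq> S" "open W" "homeomorphism V W \<Phi> g"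
    and g: "\<And>m. holo (\<lambda>y. g y $ m) W"
    using straightening[OF S h nz[OF S(2)]] unfolding \<Phi>_def by blast
  have g\<Phi>: "\<Phi> z \<in> W" "g (\<Phi> z) = z" if "z \<in> V" for z
    using VW(5) that unfolding homeomorphism_def by auto
  have \<Phi>g: "g y \<in> V" "\<Phi> (g y) = y" if "y \<in> W" for y
    using VW(5) that unfolding homeomorphism_def by auto
  obtain e where e: "e > 0" "ball (\<Phi> p) e \<subseteq> W"
    using VW(4) g\<Phi>(1)[OF VW(2)] openE by blast
  have g1: "holo (\<lambda>y. g y $ m) {y}" if "y \<in> W" for y m
    using holo_subset[OF g] that by simp
  have gS: "g y \<in> S" if "y \<in> W" for y
    using \<Phi>g(1)[OF that] VW(3) by blast
  \<comment> \<open>Implicit differentiation: \<open>g\<close> keeps all coordinates other than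
    \<open>k\<close>, and \<open>h (g y)\<close> is the coordinate \<open>y $ k\<close>, which is
    constant in direction \<open>a\<close>.\<close>
  have pdg: "pd a (\<lambda>y. g y $ m) y = (if m = k then - pd a h (g y) / pd k h (g y) else if m = a then 1 else 0)"
    if y: "y \<in> W" and a: "a \<noteq> k" for a m y
  proof -
    have ne: "pd a (\<lambda>y. g y $ m) y = (if a = m then 1 else 0)" if "m \<noteq> k" for m
    proof -
      have "g y $ m = y $ m" if "y \<in> W" for y
        using arg_cong[OF \<Phi>g(2)[OF that], of "\<lambda>v. v $ m"] \<open>m \<noteq> k\<close> by (simp add: \<Phi>_def)
      from pd_cong[OF VW(4) y this] show ?thesis by (simp add: pd_component)
    qed
    have "h (g y) = y $ k" if "y \<in> W" for y
      using arg_cong[OF \<Phi>g(2)[OF that], of "\<lambda>v. v $ k"] by (simp add: \<Phi>_def)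
    from pd_cong[OF VW(4) y this] have "pd a (\<lambda>y. h (g y)) y = 0"
      using a by (simp add: pd_component)
    moreover have "pd a (\<lambda>y. h (g y)) y = (\<Sum>m\<in>UNIV. pd m h (g y) * pd a (\<lambda>y. g y $ m) y)"
      using y by (intro pd_compose[OF h gS g1])
    moreover have "(\<Sum>m\<in>UNIV. pd m h (g y) * pd a (\<lambda>y. g y $ m) y) = (\<Sum>m\<in>UNIV.
        (if m = k then pd k h (g y) * pd a (\<lambda>y. g y $ k) y else 0) + (if m = a then pd a h (g y) else 0))"
      by (rule sum.cong[OF refl]) (use a ne in auto)
    moreover have "\<dots> = pd k h (g y) * pd a (\<lambda>y. g y $ k) y + pd a h (g y)"
      by (simp add: sum.distrib)
    ultimately have "pd k h (g y) * pd a (\<lambda>y. g y $ k) y + pd a h (g y) = 0"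
      by presburger
    then have "pd a (\<lambda>y. g y $ k) y = - pd a h (g y) / pd k h (g y)"
      using nz[OF gS[OF y]] by (simp add: nonzero_eq_divide_eq mult.commute eq_neg_iff_add_eq_0 del: divide_minus_left)
    then show ?thesis using ne[of m] by auto
  qed
  \<comment> \<open>In the new coordinates the derivative in direction \<open>a\<close> is the old
    one corrected by a multiple of \<open>pd k\<close> that annihilates \<open>h\<close>.\<close>
  have pdAg: "pd a (\<lambda>y. f (g y)) y = (pd k h (g y) * pd a f (g y) - pd a h (g y) * pd k f (g y)) / pd k h (g y)"
    if f: "holo f S" and y: "y \<in> W" and a: "a \<noteq> k" for a f y
  proof -
    have "pd m f (g y) * pd a (\<lambda>y. g y $ m) y =
        (if m = k then pd k f (g y) * (- pd a h (g y) / pd k h (g y)) else 0) + (if m = a then pd a f (g y) else 0)" for m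
      using a by (simp add: pdg[OF y a])
    then have "(\<Sum>m\<in>UNIV. pd m f (g y) * pd a (\<lambda>y. g y $ m) y)
        = pd k f (g y) * (- pd a h (g y) / pd k h (g y)) + pd a f (g y)"
      by (simp add: sum.distrib)
    then show ?thesis
      using pd_compose[OF f gS[OF y] g1[OF y], of a] nz[OF gS[OF y]] by (simp add: field_simps)
  qed
  have hg: "holo (\<lambda>y. f (g y)) (ball (\<Phi> p) e)" if "holo f S" for f
    by (subst holo_iff_singletons) (use holo_compose_at[OF that gS g1] e(2) in blast)
  have closed: "pd i (\<lambda>y. B (g y)) y = pd j (\<lambda>y. A (g y)) y" if "y \<in> ball (\<Phi> p) e" for y
    using that e(2) compat[OF gS, of y] pdAg[OF B, of y i] pdAg[OF A, of y j] ijk by auto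
  define F where "F = potential i j (\<Phi> p) (\<lambda>y. A (g y)) (\<lambda>y. B (g y))"
  have F: "holo F {y}" "pd i F y = A (g y)" "pd j F y = B (g y)" if "y \<in> ball (\<Phi> p) e" for y
  proof -
    show "holo F {y}" "pd i F y = A (g y)"
      unfolding F_def by (rule holo_potential pd_potential, (rule ijk hg A B closed that | assumption)+)+
    show "pd j F y = B (g y)"
      unfolding F_def potential_commute[of i]
      by (rule pd_potential, (rule ijk(1)[symmetric] hg A B closed[symmetric] that | assumption)+)
  qed
  define V' where "V' = V \<inter> \<Phi> -` ball (\<Phi> p) e"
  have "continuous_on V \<Phi>" using VW(5) unfolding homeomorphism_def by blast
  then have V': "open V'" unfolding V'_def using VW(1) by (simp add: continuous_open_preimage)
  have pV': "p \<in> V'" "V' \<subseteq> S" unfolding V'_def using VW e(1) by auto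
  \<comment> \<open>The terms with \<open>pd k F\<close> are proportional to the gradient of
    \<open>h\<close> and cancel in both combinations on the left of the system.\<close>
  have main: "holo (\<lambda>z. F (\<Phi> z)) {z}"
    "pd a (\<lambda>z. F (\<Phi> z)) z = pd k F (\<Phi> z) * pd a h z + (if a = k then 0 else pd a F (\<Phi> z))"
    if z: "z \<in> V'" for z a
  proof -
    have zS: "holo h {z}" using z pV'(2) holo_subset[OF h] by blast
    have F': "holo F (ball (\<Phi> p) e)" by (subst holo_iff_singletons) (use F(1) in blast)
    have b: "\<Phi> z \<in> ball (\<Phi> p) e" using z by (simp add: V'_def)
    have 1: "(\<lambda>z. \<Phi> z $ m) = (if m = k then h else (\<lambda>z. z $ m))" for m
      by (auto simp: \<Phi>_def)
    have 2: "holo (\<lambda>z. \<Phi> z $ m) {z}" for m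
      unfolding 1 using zS holo_component by simp
    show "holo (\<lambda>z. F (\<Phi> z)) {z}" by (rule holo_compose_at[OF F' b 2])
    have "pd m F (\<Phi> z) * pd a (\<lambda>z. \<Phi> z $ m) z
        = (if m = k then pd k F (\<Phi> z) * pd a h z else 0) + (if m = a then if a = k then 0 else pd a F (\<Phi> z) else 0)" for m
      unfolding 1 by (auto simp: pd_component)
    then show "pd a (\<lambda>z. F (\<Phi> z)) z = pd k F (\<Phi> z) * pd a h z + (if a = k then 0 else pd a F (\<Phi> z))"
      unfolding pd_compose[OF F' b 2] by (simp add: sum.distrib)
  qed
  have "holo (\<lambda>z. F (\<Phi> z)) V'" by (subst holo_iff_singletons) (use main(1) in blast)
  moreover have "pd k h z * pd i (\<lambda>z. F (\<Phi> z)) z - pd i h z * pd k (\<lambda>z. F (\<Phi> z)) z = pd k h z * A z \<and>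
      pd k h z * pd j (\<lambda>z. F (\<Phi> z)) z - pd j h z * pd k (\<lambda>z. F (\<Phi> z)) z = pd k h z * B z"
    if "z \<in> V'" for z
  proof -
    have "\<Phi> z \<in> ball (\<Phi> p) e" "g (\<Phi> z) = z" using that g\<Phi>(2) by (auto simp: V'_def)
    then show ?thesis using F(2,3)[of "\<Phi> z"] ijk by (simp add: main(2)[OF that] algebra_simps)
  qed
  ultimately show ?thesis using V' pV' by blast
qed

section \<open>Jet identities on solutions\<close>

lemma L_eq: "L u i j k f = (\<lambda>z. pd j (pd k u) z * pd i f z - pd i (pd k u) z * pd j f z)"
  by (simp add: fun_eq_iff L_def)

text \<open>The index order and the domain are parameters, so one computation serves all three pairs
  and all subdomains. The relation of the coefficients is solved for \<open>\<alpha>\<close> so that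
  it rewrites the polynomial identities.\<close>

locale heavenly =
  fixes \<alpha> \<beta> \<gamma> :: complex and S :: "(complex ^ 4) set" and u :: fn and a b c d :: 4
  assumes open_S: "open S" and holo_u: "holo u S" and coeff_sum: "\<alpha> = - \<beta> - \<gamma>"
    and heavenly: "\<And>z. z \<in> S \<Longrightarrow> \<alpha> * pd a (pd b u) z * pd c (pd d u) z
      + \<beta> * pd a (pd c u) z * pd b (pd d u) z + \<gamma> * pd a (pd d u) z * pd b (pd c u) z = 0"
begin

lemma holo_jet:
  assumes "holo f S" "z \<in> S"
  shows "holo f {z}" "holo (pd i f) {z}" "holo (pd i (pd j f)) {z}"
  using holo_pd[OF open_S assms(1)] holo_pd[OF open_S holo_pd[OF open_S assms(1)]] assms
  by (auto intro: holo_subset)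

text \<open>The two adjacent transpositions; as ordered rewrite rules they bring all third
  derivatives into a normal form, after which jet identities are polynomial.\<close>

lemma pd_commute3:
  assumes "holo f S" "z \<in> S"
  shows "pd i (pd j (pd k f)) z = pd j (pd i (pd k f)) z"
    and "pd i (pd j (pd k f)) z = pd i (pd k (pd j f)) z"
  by (rule pd_commute[OF open_S holo_pd[OF open_S assms(1)] assms(2)])
    (rule pd_cong[OF open_S assms(2) pd_commute[OF open_S assms(1)]])

lemmas jet = pd_add pd_diff pd_mult pd_minus pd_const
  holo_add_at holo_diff_at holo_mult_at holo_minus_at holo_const

lemmas commute_u = pd_commute[OF open_S holo_u] pd_commute3[OF holo_u]

lemma heavenly_derivative:
  assumes "z \<in> S"
  shows "\<alpha> * (pd m (pd a (pd b u)) z * pd c (pd d u) z + pd a (pd b u) z * pd m (pd c (pd d u)) z)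
    + \<beta> * (pd m (pd a (pd c u)) z * pd b (pd d u) z + pd a (pd c u) z * pd m (pd b (pd d u)) z)
    + \<gamma> * (pd m (pd a (pd d u)) z * pd b (pd c u) z + pd a (pd d u) z * pd m (pd b (pd c u)) z) = 0"
proof -
  have "pd m (\<lambda>z. \<alpha> * pd a (pd b u) z * pd c (pd d u) z
      + \<beta> * pd a (pd c u) z * pd b (pd d u) z + \<gamma> * pd a (pd d u) z * pd b (pd c u) z) z = pd m (\<lambda>z. 0) z"
    using open_S assms heavenly by (rule pd_cong)
  then show ?thesis
    by (simp add: jet holo_jet[OF holo_u assms] algebra_simps)
qed

text \<open>This is \<open>A_hat\<close> in the index order of the locale.\<close>

definition linearization :: "fn \<Rightarrow> fn" where
  "linearization f z =
     \<alpha> * (pd c (pd d u) z * pd a (pd b f) z + pd a (pd b u) z * pd c (pd d f) z)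
   + \<beta> * (pd b (pd d u) z * pd a (pd c f) z + pd a (pd c u) z * pd b (pd d f) z)
   + \<gamma> * (pd b (pd c u) z * pd a (pd d f) z + pd a (pd d u) z * pd b (pd c f) z)"

text \<open>This ties integrability to symmetry. By the quotient rule, the left side is
  \<open>H^2\<close> times the sum of \<open>\<gamma> * L u b d c (L u a c d f / H)\<close> and
  \<open>\<beta> * L u a d c (L u b c d f / H)\<close>, the cross-derivative obstruction of the
  relations for \<open>\<phi>\<close> with \<open>f\<close> as \<open>\<psi>\<close>.\<close>

lemma linearization_identity:
  assumes f: "holo f S" and z: "z \<in> S"
  defines "H \<equiv> pd d (pd c u)"
  shows "\<gamma> * (H z * L u b d c (L u a c d f) z - L u a c d f z * L u b d c H z)
       + \<beta> * (H z * L u a d c (L u b c d f) z - L u b c d f z * L u a d c H z)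
       = - (H z)\<^sup>2 * linearization f z"
proof -
  note E = heavenly[OF z] and Ed = heavenly_derivative[OF z, of d]
  \<comment> \<open>The two bracketed factors that vanish are the equation and its derivative in direction \<open>d\<close>.\<close>
  have "\<gamma> * (H z * L u b d c (L u a c d f) z - L u a c d f z * L u b d c H z)
       + \<beta> * (H z * L u a d c (L u b c d f) z - L u b c d f z * L u a d c H z)
       + (H z)\<^sup>2 * linearization f z
       = (\<alpha> * pd a (pd b u) z * pd c (pd d u) z
      + \<beta> * pd a (pd c u) z * pd b (pd d u) z + \<gamma> * pd a (pd d u) z * pd b (pd c u) z) *
        (H z * pd c (pd d f) z - pd d (pd c (pd d u)) z * pd c f z)
       + (\<alpha> * (pd d (pd a (pd b u)) z * pd c (pd d u) z + pd a (pd b u) z * pd d (pd c (pd d u)) z)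
    + \<beta> * (pd d (pd a (pd c u)) z * pd b (pd d u) z + pd a (pd c u) z * pd d (pd b (pd d u)) z)
    + \<gamma> * (pd d (pd a (pd d u)) z * pd b (pd c u) z + pd a (pd d u) z * pd d (pd b (pd c u)) z)) *
        (H z * pd c f z)"
    unfolding linearization_def H_def L_eq unfolding coeff_sum
    by (simp add: jet holo_jet[OF holo_u z] holo_jet[OF f z])
      (simp add: commute_u[OF z] pd_commute[OF open_S f z] algebra_simps power2_eq_square)
  then show ?thesis unfolding E Ed by (simp add: eq_neg_iff_add_eq_0)
qed

text \<open>The operators \<open>L u a d c\<close> and \<open>L u b d c\<close> divided by
  \<open>H\<close> are the derivatives in directions \<open>a\<close> and \<open>b\<close> when
  \<open>pd c u\<close> replaces the \<open>d\<close>-th coordinate, so they commute. The identity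
  is this fact with denominators cleared.\<close>

lemma compatibility_identity:
  assumes f: "holo f S" and z: "z \<in> S"
  defines "H \<equiv> pd d (pd c u)"
  shows "H z * (L u a d c (L u b d c f) z - L u b d c (L u a d c f) z)
    = L u b d c f z * L u a d c H z - L u a d c f z * L u b d c H z"
  unfolding H_def L_eq
  by (simp add: jet holo_jet[OF holo_u z] holo_jet[OF f z])
    (simp add: commute_u[OF z] pd_commute[OF open_S f z] algebra_simps)

text \<open>The relations hold on an open set and may be differentiated. Inserted into the
  compatibility identity for \<open>\<phi>\<close>, they make the left side of the linearization
  identity for \<open>\<psi>\<close> vanish, and \<open>H^2\<close> cancels.\<close>

lemma linearization_eq_0:
  assumes f: "holo \<phi> S" and g: "holo \<psi> S" and z: "z \<in> S" and nz: "pd d (pd c u) z \<noteq> 0"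
    and R1: "\<And>z. z \<in> S \<Longrightarrow> L u a d c \<phi> z = \<gamma> * L u a c d \<psi> z"
    and R2: "\<And>z. z \<in> S \<Longrightarrow> L u b d c \<phi> z = - \<beta> * L u b c d \<psi> z"
  shows "linearization \<psi> z = 0"
proof -
  have L: "holo (L u i j k \<psi>) {z}" for i j k
    unfolding L_eq by (intro jet holo_jet[OF holo_u z] holo_jet[OF g z])
  have "pd m (L u a d c \<phi>) z = pd m (\<lambda>z. \<gamma> * L u a c d \<psi> z) z"
    "pd m (L u b d c \<phi>) z = pd m (\<lambda>z. - \<beta> * L u b c d \<psi> z) z" for m
    by (rule pd_cong[OF open_S z], erule R1) (rule pd_cong[OF open_S z], erule R2)
  then have "pd m (L u a d c \<phi>) z = \<gamma> * pd m (L u a c d \<psi>) z"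
    "pd m (L u b d c \<phi>) z = - \<beta> * pd m (L u b c d \<psi>) z" for m
    by (simp_all add: jet L)
  then have LL: "L u i j k (L u a d c \<phi>) z = \<gamma> * L u i j k (L u a c d \<psi>) z"
    "L u i j k (L u b d c \<phi>) z = - \<beta> * L u i j k (L u b c d \<psi>) z" for i j k
    by (simp_all add: L_def algebra_simps)
  have "(pd d (pd c u) z)\<^sup>2 * linearization \<psi> z = 0"
    using compatibility_identity[OF f z, unfolded R1[OF z] R2[OF z] LL] linearization_identity[OF g z]
    by algebra
  then show ?thesis using nz by simp
qed

text \<open>Near \<open>p\<close> the relations have the form of the commuting system for
  \<open>h = pd c u\<close>, with right sides divided by \<open>pd d h\<close>; its compatibility
  condition is the symmetry condition for \<open>\<psi>\<close>.\<close>

lemma recursion_solvable: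
  assumes g: "holo \<psi> S" and sym: "\<And>z. z \<in> S \<Longrightarrow> linearization \<psi> z = 0"
    and p: "p \<in> S" and nz: "pd d (pd c u) p \<noteq> 0" and abd: "a \<noteq> b" "a \<noteq> d" "b \<noteq> d"
  shows "\<exists>V \<phi>. open V \<and> p \<in> V \<and> V \<subseteq> S \<and> holo \<phi> V \<and> (\<forall>z\<in>V.
    L u a d c \<phi> z = \<gamma> * L u a c d \<psi> z \<and> L u b d c \<phi> z = - \<beta> * L u b c d \<psi> z)"
proof -
  define h where "h = pd c u"
  define T where "T = S \<inter> pd d h -` (- {0})"
  have hh: "holo h S" "holo (pd d h) S"
    unfolding h_def using holo_pd[OF open_S holo_pd[OF open_S holo_u]] holo_pd[OF open_S holo_u] by auto
  have T: "open T" "p \<in> T" "T \<subseteq> S"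
    unfolding T_def using continuous_open_preimage[OF holo_imp_continuous_on[OF hh(2)] open_S] p nz
    by (auto simp: h_def)
  have nzT: "pd d h z \<noteq> 0" if "z \<in> T" for z using that by (simp add: T_def)
  define Q1 where "Q1 = L u a c d \<psi>"
  define Q2 where "Q2 = L u b c d \<psi>"
  have Q: "holo Q1 {z}" "holo Q2 {z}" "holo (pd d h) {z}" if "z \<in> T" for z
  proof -
    have z: "z \<in> S" using that T(3) by blast
    show "holo Q1 {z}" "holo Q2 {z}" unfolding Q1_def Q2_def L_eq
      by (intro jet holo_jet[OF holo_u z] holo_jet[OF g z])+
    show "holo (pd d h) {z}" using hh(2) z by (auto intro: holo_subset)
  qed
  define A where "A = (\<lambda>z. \<gamma> * Q1 z / pd d h z)"
  define B where "B = (\<lambda>z. - \<beta> * Q2 z / pd d h z)"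
  have "holo A {z}" "holo B {z}" if "z \<in> T" for z
    unfolding A_def B_def by (intro holo_divide_at jet Q[OF that] nzT[OF that])+
  then have AB: "holo A T" "holo B T"
    by (subst holo_iff_singletons, blast)+
  have pdA: "pd m A z = \<gamma> * (pd d h z * pd m Q1 z - Q1 z * pd m (pd d h) z) / (pd d h z)\<^sup>2"
    and pdB: "pd m B z = - \<beta> * (pd d h z * pd m Q2 z - Q2 z * pd m (pd d h) z) / (pd d h z)\<^sup>2"
    if "z \<in> T" for m z
    unfolding A_def B_def using Q[OF that] nzT[OF that]
    by (simp_all add: pd_divide holo_divide_at jet algebra_simps diff_divide_distrib)
  have "\<exists>V \<phi>. open V \<and> p \<in> V \<and> V \<subseteq> T \<and> holo \<phi> V \<and> (\<forall>z\<in>V.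
      pd d h z * pd a \<phi> z - pd a h z * pd d \<phi> z = pd d h z * A z \<and>
      pd d h z * pd b \<phi> z - pd b h z * pd d \<phi> z = pd d h z * B z)"
  proof (rule commuting_system_solvable[OF T(1,2) abd holo_subset[OF hh(1) T(3)] AB nzT])
    fix z assume z: "z \<in> T"
    then have zS: "z \<in> S" using T(3) by blast
    \<comment> \<open>The linearization identity with right side 0 is the compatibility condition
      multiplied by the square of \<open>pd d h z\<close>.\<close>
    have "- \<beta> * (pd d h z * L u a d c Q2 z - Q2 z * L u a d c (pd d h) z)
        = \<gamma> * (pd d h z * L u b d c Q1 z - Q1 z * L u b d c (pd d h) z)"
      using linearization_identity[OF g zS] unfolding sym[OF zS] Q1_def Q2_def h_def by algebra
    moreover have "pd d h z * pd a B z - pd a h z * pd d B z =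
        - \<beta> * (pd d h z * L u a d c Q2 z - Q2 z * L u a d c (pd d h) z) / (pd d h z)\<^sup>2"
      unfolding pdB[OF z] L_def h_def
      by (simp add: algebra_simps add_divide_distrib diff_divide_distrib)
    moreover have "pd d h z * pd b A z - pd b h z * pd d A z =
        \<gamma> * (pd d h z * L u b d c Q1 z - Q1 z * L u b d c (pd d h) z) / (pd d h z)\<^sup>2"
      unfolding pdA[OF z] L_def h_def
      by (simp add: algebra_simps add_divide_distrib diff_divide_distrib)
    ultimately show "pd d h z * pd a B z - pd a h z * pd d B z = pd d h z * pd b A z - pd b h z * pd d A z"
      by (simp only:)
  qed
  then obtain V \<phi> where V: "open V" "p \<in> V" "V \<subseteq> T" "holo \<phi> V"
    and eq: "\<And>z. z \<in> V \<Longrightarrow> pd d h z * pd a \<phi> z - pd a h z * pd d \<phi> z = pd d h z * A z"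
      "\<And>z. z \<in> V \<Longrightarrow> pd d h z * pd b \<phi> z - pd b h z * pd d \<phi> z = pd d h z * B z"
    by blast
  have "pd d h z * A z = \<gamma> * Q1 z" "pd d h z * B z = - \<beta> * Q2 z" if "z \<in> V" for z
    using nzT V(3) that by (auto simp: A_def B_def)
  with eq have "\<forall>z\<in>V. L u a d c \<phi> z = \<gamma> * L u a c d \<psi> z \<and> L u b d c \<phi> z = - \<beta> * L u b c d \<psi> z"
    unfolding L_def[of u _ d c] Q1_def[symmetric] Q2_def[symmetric] h_def[symmetric] by simp
  with V T(3) show ?thesis by blast
qed

section \<open>Commutators of the Lax operators in a general index order\<close>

definition lax_op_1 :: "complex \<Rightarrow> complex \<Rightarrow> op" where
  "lax_op_1 s l f z = s * (L u a d c f z + l * \<gamma> * L u a c d f z)"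

definition lax_op_2 :: "complex \<Rightarrow> op" where
  "lax_op_2 l f z = - L u b d c f z + l * \<beta> * L u b c d f z"

lemma lax_op_eq:
  "lax_op_1 s l f = (\<lambda>z. s * (L u a d c f z + l * \<gamma> * L u a c d f z))"
  "lax_op_2 l f = (\<lambda>z. - L u b d c f z + l * \<beta> * L u b c d f z)"
  by (simp_all add: fun_eq_iff lax_op_1_def lax_op_2_def)

lemma holo_lax_op:
  assumes "holo f S"
  shows "holo (lax_op_1 s l f) S" "holo (lax_op_2 l f) S"
proof -
  have "holo (lax_op_1 s l f) {z}" "holo (lax_op_2 l f) {z}" if "z \<in> S" for z
    unfolding lax_op_eq L_eq by (intro jet holo_jet[OF holo_u that] holo_jet[OF assms that])+
  then show "holo (lax_op_1 s l f) S" "holo (lax_op_2 l f) S"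
    by (subst holo_iff_singletons, blast)+
qed

text \<open>The difference of the two sides is a combination of the equation and its derivatives in
  directions \<open>c\<close> and \<open>d\<close>. The coefficients needed for involution are thus
  Lax operators applied to \<open>H\<close>, over the denominator \<open>H\<close>.\<close>

lemma lax_commutator:
  assumes f: "holo f S" and z: "z \<in> S"
  defines "H \<equiv> pd d (pd c u)"
  shows "H z * commutator (lax_op_1 s l) (lax_op_2 l) f z
    = - lax_op_2 l H z * lax_op_1 s l f z + lax_op_1 s l H z * lax_op_2 l f z"
proof -
  note E = heavenly[OF z] and Ec = heavenly_derivative[OF z, of c] and Ed = heavenly_derivative[OF z, of d]
  have "H z * commutator (lax_op_1 s l) (lax_op_2 l) f z
    - (- lax_op_2 l H z * lax_op_1 s l f z + lax_op_1 s l H z * lax_op_2 l f z)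
    = s * l * ((\<alpha> * pd a (pd b u) z * pd c (pd d u) z
      + \<beta> * pd a (pd c u) z * pd b (pd d u) z + \<gamma> * pd a (pd d u) z * pd b (pd c u) z) *
        (pd d f z * pd c (pd c (pd d u)) z - pd c f z * pd d (pd c (pd d u)) z)
      - (\<alpha> * (pd c (pd a (pd b u)) z * pd c (pd d u) z + pd a (pd b u) z * pd c (pd c (pd d u)) z)
    + \<beta> * (pd c (pd a (pd c u)) z * pd b (pd d u) z + pd a (pd c u) z * pd c (pd b (pd d u)) z)
    + \<gamma> * (pd c (pd a (pd d u)) z * pd b (pd c u) z + pd a (pd d u) z * pd c (pd b (pd c u)) z)) *
        H z * pd d f z
      + (\<alpha> * (pd d (pd a (pd b u)) z * pd c (pd d u) z + pd a (pd b u) z * pd d (pd c (pd d u)) z)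
    + \<beta> * (pd d (pd a (pd c u)) z * pd b (pd d u) z + pd a (pd c u) z * pd d (pd b (pd d u)) z)
    + \<gamma> * (pd d (pd a (pd d u)) z * pd b (pd c u) z + pd a (pd d u) z * pd d (pd b (pd c u)) z)) *
        H z * pd c f z)"
    unfolding H_def commutator_def lax_op_eq L_eq unfolding coeff_sum
    by (simp add: jet holo_jet[OF holo_u z] holo_jet[OF f z])
      (simp add: commute_u[OF z] pd_commute[OF open_S f z] algebra_simps)
  then show ?thesis unfolding E Ec Ed by simp
qed

text \<open>If \<open>H\<close> vanishes identically, multiplying by it loses all information; but
  then its derivatives vanish too, and the commutator itself is a combination of the differentiated
  equations.\<close>

lemma lax_commutator_degenerate:
  assumes f: "holo f S" and z: "z \<in> S" and H: "\<And>z. z \<in> S \<Longrightarrow> pd d (pd c u) z = 0"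
  shows "commutator (lax_op_1 s l) (lax_op_2 l) f z = 0"
proof -
  note Ec = heavenly_derivative[OF z, of c] and Ed = heavenly_derivative[OF z, of d]
  have H3: "pd m (pd d (pd c u)) z = 0" for m
    using pd_cong[OF open_S z H] by (simp add: pd_const)
  have H0: "pd d (pd c u) z = 0" "pd c (pd d u) z = 0" 
    using H[OF z] commute_u(1)[OF z, of c d] by simp_all
  have H1: "pd m (pd c (pd d u)) z = 0" "pd c (pd m (pd d u)) z = 0" "pd d (pd m (pd c u)) z = 0"
     "pd d (pd c (pd m u)) z = 0" "pd c (pd d (pd m u)) z = 0" for m
    using H3[of m] commute_u(2,3)[OF z] by metis+
  have "commutator (lax_op_1 s l) (lax_op_2 l) f z
    = s * l * ((\<alpha> * (pd d (pd a (pd b u)) z * pd c (pd d u) z + pd a (pd b u) z * pd d (pd c (pd d u)) z)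
    + \<beta> * (pd d (pd a (pd c u)) z * pd b (pd d u) z + pd a (pd c u) z * pd d (pd b (pd d u)) z)
    + \<gamma> * (pd d (pd a (pd d u)) z * pd b (pd c u) z + pd a (pd d u) z * pd d (pd b (pd c u)) z)) * pd c f z
    - (\<alpha> * (pd c (pd a (pd b u)) z * pd c (pd d u) z + pd a (pd b u) z * pd c (pd c (pd d u)) z)
    + \<beta> * (pd c (pd a (pd c u)) z * pd b (pd d u) z + pd a (pd c u) z * pd c (pd b (pd d u)) z)
    + \<gamma> * (pd c (pd a (pd d u)) z * pd b (pd c u) z + pd a (pd d u) z * pd c (pd b (pd c u)) z)) * pd d f z)"
    unfolding commutator_def lax_op_eq L_eq
    by (simp add: jet holo_jet[OF holo_u z] holo_jet[OF f z] H0 H1 H3)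
      (simp add: commute_u[OF z] pd_commute[OF open_S f z] H0 H1 H3 algebra_simps)
  then show ?thesis unfolding Ec Ed by simp
qed

text \<open>At a zero of \<open>H\<close> both operators involve only \<open>pd c\<close> and
  \<open>pd d\<close>, and the equation makes their determinant vanish. Hence \<open>H\<close> has
  no zeros where the operators are independent and is admissible as the denominator.\<close>

lemma lax_dependent:
  assumes z: "z \<in> S" and H: "pd d (pd c u) z = 0"
  shows "\<not> indep_at S (lax_op_1 s l) (lax_op_2 l) z"
proof
  assume "indep_at S (lax_op_1 s l) (lax_op_2 l) z"
  then have ind: "p = 0 \<and> q = 0" if "\<And>f. p * lax_op_1 s l f z + q * lax_op_2 l f z = 0" for p q
    using that unfolding indep_at_def by blast
  have H': "pd c (pd d u) z = 0" using H commute_u(1)[OF z, of c d] by simp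
  have E: "\<beta> * pd a (pd c u) z * pd b (pd d u) z + \<gamma> * pd a (pd d u) z * pd b (pd c u) z = 0"
    using heavenly[OF z] H' by simp
  have X: "lax_op_1 s l f z = s * (- pd a (pd c u) z * pd d f z - l * \<gamma> * pd a (pd d u) z * pd c f z)"
    and Y: "lax_op_2 l f z = pd b (pd c u) z * pd d f z - l * \<beta> * pd b (pd d u) z * pd c f z" for f
    by (simp_all add: lax_op_1_def lax_op_2_def L_def H H' algebra_simps)
  \<comment> \<open>This combination eliminates \<open>pd d\<close>, and its \<open>pd c\<close>
    coefficient vanishes by \<open>E\<close>; independence then forces both multipliers to be 0,
    leaving two multiples of \<open>pd c\<close>.\<close>
  have "pd b (pd c u) z * lax_op_1 s l f z + s * pd a (pd c u) z * lax_op_2 l f z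
      = - s * l * pd c f z * (\<beta> * pd a (pd c u) z * pd b (pd d u) z + \<gamma> * pd a (pd d u) z * pd b (pd c u) z)" for f
    unfolding X Y by (simp add: algebra_simps)
  then have 1: "pd b (pd c u) z = 0" "s * pd a (pd c u) z = 0"
    using ind[of "pd b (pd c u) z" "s * pd a (pd c u) z"] unfolding E by simp_all
  have X1: "lax_op_1 s l f z = - s * l * \<gamma> * pd a (pd d u) z * pd c f z" for f
  proof -
    have "lax_op_1 s l f z = - (s * pd a (pd c u) z) * pd d f z - s * l * \<gamma> * pd a (pd d u) z * pd c f z"
      unfolding X by (simp add: algebra_simps)
    then show ?thesis unfolding 1(2) by simp
  qed
  have Y1: "lax_op_2 l f z = - l * \<beta> * pd b (pd d u) z * pd c f z" for f
    unfolding Y 1 by simp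
  have 2: "l * \<beta> * pd b (pd d u) z = 0 \<and> - s * l * \<gamma> * pd a (pd d u) z = 0"
    by (rule ind) (simp add: X1 Y1)
  \<comment> \<open>By \<open>2\<close> both operators vanish at \<open>z\<close>, so even the
    multipliers 1 and 1 give a relation.\<close>
  have "(1::complex) = 0 \<and> (1::complex) = 0"
    by (rule ind) (use 2 in \<open>auto simp: X1 Y1\<close>)
  then show False by simp
qed

text \<open>The denominator is \<open>H\<close> unless it vanishes identically; in that case the
  commutator is 0 and the coefficients 1, 0, 0 serve.\<close>

lemma lax_in_involution: 
  assumes "S \<noteq> {}"
  shows "in_involution S (lax_op_1 s l) (lax_op_2 l)"
proof (cases "\<forall>z\<in>S. pd d (pd c u) z = 0")
  case True
  then show ?thesis
    unfolding in_involution_def using assms lax_commutator_degenerate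
    by (intro exI[of _ "\<lambda>_. 1"] exI[of _ "\<lambda>_. 0"]) (auto simp: holo_const)
next
  case False
  define H where "H = pd d (pd c u)"
  have H: "holo H S"
    unfolding H_def by (intro holo_pd open_S holo_u)
  have "holo (\<lambda>z. - lax_op_2 l H z) S"
    using holo_lax_op(2)[OF H, of l] holo_minus_at
    by (subst holo_iff_singletons) (auto intro: holo_subset)
  then show ?thesis
    unfolding in_involution_def
    using H holo_lax_op(1)[OF H, of s l] False lax_dependent lax_commutator[folded H_def]
    unfolding H_def[symmetric]
    by (intro exI[of _ H] exI[of _ "\<lambda>z. - lax_op_2 l H z"] exI[of _ "lax_op_1 s l H"]) blast
qed

end

section \<open>Recursion operators\<close>

lemma L_scale: "holo f {z} \<Longrightarrow> L u i j k (\<lambda>z. r * f z) z = r * L u i j k f z"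
  by (simp add: L_def pd_mult[OF holo_const] pd_const right_diff_distrib mult.left_commute)

context heavenly
begin

lemma holo_linearization:
  assumes "holo f S"
  shows "holo (linearization f) S"
proof -
  have "holo (linearization f) {z}" if "z \<in> S" for z
    unfolding linearization_def[abs_def] by (intro jet holo_jet[OF holo_u that] holo_jet[OF assms that])
  then show ?thesis by (subst holo_iff_singletons) blast
qed

lemma swap_heavenly: "heavenly \<alpha> \<gamma> \<beta> S u a b d c"
proof
  show "\<alpha> = - \<gamma> - \<beta>" using coeff_sum by simp
  fix z assume z: "z \<in> S"
  show "\<alpha> * pd a (pd b u) z * pd d (pd c u) z + \<gamma> * pd a (pd d u) z * pd b (pd c u) z
      + \<beta> * pd a (pd c u) z * pd b (pd d u) z = 0"
    using heavenly[OF z] commute_u(1)[OF z, of d c] by (simp add: add_ac)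
qed (fact open_S holo_u)+

lemma swap_linearization:
  assumes "holo f S" "z \<in> S"
  shows "heavenly.linearization \<alpha> \<gamma> \<beta> u a b d c f z = linearization f z"
proof -
  interpret swap: heavenly \<alpha> \<gamma> \<beta> S u a b d c by (rule swap_heavenly)
  show ?thesis
    unfolding linearization_def swap.linearization_def
    using commute_u(1)[OF assms(2), of d c] pd_commute[OF open_S assms, of d c] by (simp add: add_ac)
qed

lemma linearization_eq_0':
  assumes f: "holo \<phi> S" and g: "holo \<psi> S" and z: "z \<in> S" and nz: "pd d (pd c u) z \<noteq> 0"
    and R1: "\<And>z. z \<in> S \<Longrightarrow> L u a d c \<phi> z = \<gamma> * L u a c d \<psi> z"
    and R2: "\<And>z. z \<in> S \<Longrightarrow> L u b d c \<phi> z = - \<beta> * L u b c d \<psi> z"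
  shows "linearization \<phi> z = 0"
proof -
  interpret swap: heavenly \<alpha> \<gamma> \<beta> S u a b d c by (rule swap_heavenly)
  \<comment> \<open>In the exchanged roles \<open>?\<omega>\<close> stands for the first function
    and \<open>\<phi>\<close> for the second. The factor \<open>\<beta> * \<gamma>\<close> makes the
    coefficients of the exchanged relations come out as \<open>\<beta>\<close> and
    \<open>- \<gamma>\<close>.\<close>
  let ?\<omega> = "\<lambda>z. \<beta> * \<gamma> * \<psi> z"
  have "holo ?\<omega> S"
    by (subst holo_iff_singletons) (intro ballI holo_mult_at holo_const holo_jet(1)[OF g])
  then have "swap.linearization \<phi> z = 0"
  proof (rule swap.linearization_eq_0[OF _ f z])
    show "pd c (pd d u) z \<noteq> 0" using nz commute_u(1)[OF z, of c d] by simp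
    fix z assume z: "z \<in> S"
    show "L u a c d ?\<omega> z = \<beta> * L u a d c \<phi> z" "L u b c d ?\<omega> z = - \<gamma> * L u b d c \<phi> z"
      using R1[OF z] R2[OF z] by (simp_all add: L_scale[OF holo_jet(1)[OF g z]])
  qed
  then show ?thesis using swap_linearization[OF f z] by simp
qed

lemma recursion_solvable':
  assumes f: "holo \<phi> S" and sym: "\<And>z. z \<in> S \<Longrightarrow> linearization \<phi> z = 0"
    and p: "p \<in> S" and nz: "pd d (pd c u) p \<noteq> 0" and abc: "a \<noteq> b" "a \<noteq> c" "b \<noteq> c"
    and \<beta>\<gamma>: "\<beta> \<noteq> 0" "\<gamma> \<noteq> 0"
  shows "\<exists>V \<psi>. open V \<and> p \<in> V \<and> V \<subseteq> S \<and> holo \<psi> V \<and> (\<forall>z\<in>V.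
    L u a d c \<phi> z = \<gamma> * L u a c d \<psi> z \<and> L u b d c \<phi> z = - \<beta> * L u b c d \<psi> z)"
proof -
  interpret swap: heavenly \<alpha> \<gamma> \<beta> S u a b d c by (rule swap_heavenly)
  have "pd c (pd d u) p \<noteq> 0" using nz commute_u(1)[OF p, of c d] by simp
  moreover have "swap.linearization \<phi> z = 0" if "z \<in> S" for z
    using swap_linearization[OF f that] sym[OF that] by simp
  ultimately obtain V \<omega> where V: "open V" "p \<in> V" "V \<subseteq> S" "holo \<omega> V"
    and R: "\<And>z. z \<in> V \<Longrightarrow> L u a c d \<omega> z = \<beta> * L u a d c \<phi> z" "\<And>z. z \<in> V \<Longrightarrow> L u b c d \<omega> z = - \<gamma> * L u b d c \<phi> z"
    using swap.recursion_solvable[OF f _ p _ abc] by blast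
  \<comment> \<open>Undoes the factor \<open>\<beta> * \<gamma>\<close> of the exchange, which is
    where both must be nonzero.\<close>
  let ?\<psi> = "\<lambda>z. 1 / (\<beta> * \<gamma>) * \<omega> z"
  have h: "holo \<omega> {z}" if "z \<in> V" for z using holo_subset[OF V(4)] that by simp
  then have "holo ?\<psi> V"
    by (subst holo_iff_singletons) (intro ballI holo_mult_at holo_const h)
  moreover have "L u a d c \<phi> z = \<gamma> * L u a c d ?\<psi> z \<and> L u b d c \<phi> z = - \<beta> * L u b c d ?\<psi> z" if "z \<in> V" for z
    unfolding L_scale[OF h[OF that]] R[OF that] using \<beta>\<gamma> by simp
  ultimately show ?thesis using V by blast
qed

end

section \<open>Transfer to the three index orders\<close>

lemma ghe_solution_heavenly:
  assumes "\<alpha> + \<beta> + \<gamma> = 0" and sol: "ghe_solution \<alpha> \<beta> \<gamma> \<Omega> u" and U: "open U" "U \<subseteq> \<Omega>"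
    and perm: "(a, b, c, d) \<in> {(1, 2, 3, 4), (3, 4, 1, 2), (4, 3, 2, 1)}"
  shows "heavenly \<alpha> \<beta> \<gamma> U u a b c d"
proof
  show "open U" by fact
  show u: "holo u U" using sol U(2) by (auto simp: ghe_solution_def intro: holo_subset)
  show "\<alpha> = - \<beta> - \<gamma>" using assms(1) by (simp add: eq_diff_eq eq_neg_iff_add_eq_0 add_ac)
  fix z assume z: "z \<in> U"
  then have "\<alpha> * pd 1 (pd 2 u) z * pd 3 (pd 4 u) z + \<beta> * pd 1 (pd 3 u) z * pd 2 (pd 4 u) z
      + \<gamma> * pd 1 (pd 4 u) z * pd 2 (pd 3 u) z = 0"
    using sol U(2) unfolding ghe_solution_def by blast
  moreover note com = pd_commute[OF U(1) u z]
  ultimately show "\<alpha> * pd a (pd b u) z * pd c (pd d u) z + \<beta> * pd a (pd c u) z * pd b (pd d u) z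
      + \<gamma> * pd a (pd d u) z * pd b (pd c u) z = 0"
    using perm com[of 3 1] com[of 4 2] com[of 3 2] com[of 4 1] com[of 4 3] com[of 2 1]
    by (auto simp: mult_ac)
qed

lemma linearization_eq_A_hat:
  assumes h: "heavenly \<alpha> \<beta> \<gamma> U u a b c d" and f: "holo f U" and z: "z \<in> U"
    and perm: "(a, b, c, d) \<in> {(1, 2, 3, 4), (3, 4, 1, 2), (4, 3, 2, 1)}"
  shows "heavenly.linearization \<alpha> \<beta> \<gamma> u a b c d f z = A_hat \<alpha> \<beta> \<gamma> u f z"
proof -
  interpret heavenly \<alpha> \<beta> \<gamma> U u a b c d by fact
  note com = commute_u(1)[OF z] and comf = pd_commute[OF open_S f z]
  show ?thesis
    unfolding linearization_def A_hat_def
    using perm com[of 3 1] com[of 4 2] com[of 3 2] com[of 4 1] com[of 4 3] com[of 2 1]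
      comf[of 3 1] comf[of 4 2] comf[of 3 2] comf[of 4 1] comf[of 4 3] comf[of 2 1]
    by (auto simp: add_ac)
qed

lemma determines_recursion_operatorI:
  assumes sum0: "\<alpha> + \<beta> + \<gamma> = 0"
    and perm: "(a, b, c, d) \<in> {(1, 2, 3, 4), (3, 4, 1, 2), (4, 3, 2, 1)}"
    and ij: "(i, j) \<in> {(c, d), (d, c)}"
    and R: "\<And>u \<phi> \<psi> z. R u \<phi> \<psi> z \<longleftrightarrow>
      L u a d c \<phi> z = \<gamma> * L u a c d \<psi> z \<and> L u b d c \<phi> z = - \<beta> * L u b c d \<psi> z"
  shows "determines_recursion_operator \<alpha> \<beta> \<gamma> i j R"
  unfolding determines_recursion_operator_def
proof (intro allI impI, elim conjE bexE, intro conjI allI impI; (elim conjE)?)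
  fix \<Omega> u z0
  assume sol: "ghe_solution \<alpha> \<beta> \<gamma> \<Omega> u" and z0: "z0 \<in> \<Omega>" "pd i (pd j u) z0 \<noteq> 0"
  have \<Omega>: "open \<Omega>" "connected \<Omega>" "holo u \<Omega>" using sol by (auto simp: ghe_solution_def)
  have H: "pd i (pd j u) z = pd d (pd c u) z" if "z \<in> \<Omega>" for z
    using ij pd_commute[OF \<Omega>(1,3) that, of c d] by auto
  have abcd: "a \<noteq> b" "a \<noteq> c" "b \<noteq> c" "a \<noteq> d" "b \<noteq> d" using perm by auto
  note heav = ghe_solution_heavenly[OF sum0 sol _ _ perm]
  note lin = linearization_eq_A_hat[OF _ _ _ perm]
  {
    fix U \<phi> \<psi>
    assume U: "open U" "U \<subseteq> \<Omega>" and f: "holo \<phi> U" and g: "holo \<psi> U" and rel: "\<forall>z\<in>U. R u \<phi> \<psi> z"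
    interpret heavenly \<alpha> \<beta> \<gamma> U u a b c d by (rule heav[OF U])
    note R1 = rel[unfolded R, THEN bspec, THEN conjunct1]
    note R2 = rel[unfolded R, THEN bspec, THEN conjunct2]
    \<comment> \<open>If \<open>k z \<noteq> 0\<close>, then \<open>k\<close> has no zeros on an
      open set \<open>T\<close>, so \<open>H\<close> vanishes on \<open>T\<close>; by the identity
      theorem on the connected domain \<open>H\<close> would vanish everywhere, also at
      \<open>z0\<close>.\<close>
    have vanish: "k z = 0" if k: "holo k U" and z: "z \<in> U"
      and k0: "\<And>z. z \<in> U \<Longrightarrow> pd d (pd c u) z \<noteq> 0 \<Longrightarrow> k z = 0" for k z
    proof (rule ccontr)
      assume kz: "k z \<noteq> 0"
      define T where "T = U \<inter> k -` (- {0})"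
      have T: "open T" "T \<noteq> {}" "T \<subseteq> \<Omega>"
        using continuous_open_preimage[OF holo_imp_continuous_on[OF k] U(1), of "- {0}"] z kz U(2)
        by (auto simp: T_def)
      have "pd i (pd j u) z = 0" if "z \<in> T" for z
      proof -
        have "z \<in> U" "k z \<noteq> 0" "z \<in> \<Omega>" using that U(2) by (auto simp: T_def)
        then show ?thesis using k0[of z] H[of z] by auto
      qed
      then have "pd i (pd j u) z0 = 0"
        by (rule holo_eq_0_continuation[OF \<Omega>(1,2) holo_pd[OF \<Omega>(1) holo_pd[OF \<Omega>(1,3)]] T _ z0(1)])
      then show False using z0(2) by simp
    qed
    have "linearization \<phi> z = 0" if "z \<in> U" for z
      by (rule vanish[OF holo_linearization[OF f] that linearization_eq_0'[OF f g _ _ R1 R2]])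
    then show "symmetry \<alpha> \<beta> \<gamma> u U \<phi>"
      using f lin[OF heavenly_axioms f] by (simp add: symmetry_def)
    have "linearization \<psi> z = 0" if "z \<in> U" for z
      by (rule vanish[OF holo_linearization[OF g] that linearization_eq_0[OF f g _ _ R1 R2]])
    then show "symmetry \<alpha> \<beta> \<gamma> u U \<psi>"
      using g lin[OF heavenly_axioms g] by (simp add: symmetry_def)
  next
    fix U \<psi> p
    assume U: "open U" "U \<subseteq> \<Omega>" and sym: "symmetry \<alpha> \<beta> \<gamma> u U \<psi>" and p: "p \<in> U" "pd i (pd j u) p \<noteq> 0"
    interpret heavenly \<alpha> \<beta> \<gamma> U u a b c d by (rule heav[OF U])
    have g: "holo \<psi> U" using sym by (simp add: symmetry_def)
    have "pd d (pd c u) p \<noteq> 0" using p H U(2) by auto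
    moreover have "linearization \<psi> z = 0" if "z \<in> U" for z
      using sym that lin[OF heavenly_axioms g that] by (simp add: symmetry_def)
    ultimately show "\<exists>V \<phi>. open V \<and> p \<in> V \<and> V \<subseteq> U \<and> holo \<phi> V \<and> (\<forall>z\<in>V. R u \<phi> \<psi> z)"
      unfolding R by (intro recursion_solvable[OF g _ p(1)] abcd)
  next
    fix U \<phi> p
    assume U: "open U" "U \<subseteq> \<Omega>" and sym: "symmetry \<alpha> \<beta> \<gamma> u U \<phi>" and p: "p \<in> U" "pd i (pd j u) p \<noteq> 0"
      and \<beta>\<gamma>: "\<beta> \<noteq> 0" "\<gamma> \<noteq> 0"
    interpret heavenly \<alpha> \<beta> \<gamma> U u a b c d by (rule heav[OF U])
    have f: "holo \<phi> U" using sym by (simp add: symmetry_def)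
    have "pd d (pd c u) p \<noteq> 0" using p H U(2) by auto
    moreover have "linearization \<phi> z = 0" if "z \<in> U" for z
      using sym that lin[OF heavenly_axioms f that] by (simp add: symmetry_def)
    ultimately show "\<exists>V \<psi>. open V \<and> p \<in> V \<and> V \<subseteq> U \<and> holo \<psi> V \<and> (\<forall>z\<in>V. R u \<phi> \<psi> z)"
      unfolding R by (intro recursion_solvable'[OF f _ p(1)] abcd \<beta>\<gamma>)
  }
qed

section \<open>Lax pairs\<close>

lemma is_lax_pairI:
  assumes "\<alpha> + \<beta> + \<gamma> = 0" "(a, b, c, d) \<in> {(1, 2, 3, 4), (3, 4, 1, 2), (4, 3, 2, 1)}"
    and P: "\<And>u l. P u l = (\<lambda>f z. s * (L u a d c f z + l * \<gamma> * L u a c d f z),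
      \<lambda>f z. - L u b d c f z + l * \<beta> * L u b c d f z)"
  shows "is_lax_pair \<alpha> \<beta> \<gamma> P"
  unfolding is_lax_pair_def
proof (intro allI impI)
  fix \<Omega> u l
  assume sol: "ghe_solution \<alpha> \<beta> \<gamma> \<Omega> u"
  then have "open \<Omega>" "\<Omega> \<noteq> {}" by (auto simp: ghe_solution_def)
  interpret heavenly \<alpha> \<beta> \<gamma> \<Omega> u a b c d
    by (rule ghe_solution_heavenly[OF assms(1) sol \<open>open \<Omega>\<close> order_refl assms(2)])
  have "fst (P u l) = lax_op_1 s l" "snd (P u l) = lax_op_2 l"
    unfolding P by (simp_all add: fun_eq_iff lax_op_1_def lax_op_2_def)
  then show "in_involution \<Omega> (fst (P u l)) (snd (P u l))"
    using lax_in_involution[OF \<open>\<Omega> \<noteq> {}\<close>] by simp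
qed

section \<open>A solution on which the three pairs span different planes\<close>

definition square_solution :: fn where
  "square_solution z = 1 / 2 * ((z $ 1 + z $ 2 + z $ 3 + z $ 4) * (z $ 1 + z $ 2 + z $ 3 + z $ 4))"

lemma holo_square_solution: "holo square_solution S"
proof -
  have "holo square_solution {z}" for z
    unfolding square_solution_def[abs_def] by (intro holo_mult_at holo_add_at holo_component holo_const)
  then show ?thesis by (subst holo_iff_singletons) blast
qed

text \<open>Half the square of the coordinate sum has the coordinate sum as each first derivative.
  With all second derivatives 1, the equation reads \<open>\<alpha> + \<beta> + \<gamma> = 0\<close>
  and every point is generic.\<close>

lemma pd_pd_square_solution: "pd i (pd j square_solution) z = 1"
proof -
  have s: "holo (\<lambda>z. z $ 1 + z $ 2 + z $ 3 + z $ 4) {z}" "pd i (\<lambda>z. z $ 1 + z $ 2 + z $ 3 + z $ 4) z = 1" for i z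
    using exhaust_4[of i] by (auto simp: pd_add holo_add_at holo_component pd_component)
  have "pd j square_solution = (\<lambda>z. z $ 1 + z $ 2 + z $ 3 + z $ 4)"
    unfolding square_solution_def[abs_def]
    by (rule ext) (simp only: pd_mult[OF holo_const holo_mult_at[OF s(1) s(1)]] pd_mult[OF s(1) s(1)] s(2) pd_const, simp)
  then show ?thesis by (simp add: s)
qed

lemma L_square_solution_component:
  "L square_solution i j k (\<lambda>z. z $ m) z = (if i = m then 1 else 0) - (if j = m then 1 else 0)"
  by (simp add: L_def pd_pd_square_solution pd_component)

lemma not_equivalent_pairsI:
  assumes "\<alpha> + \<beta> + \<gamma> = 0"
    and "\<not> same_span_at UNIV (P square_solution 0) (Q square_solution 0) 0"
  shows "\<not> equivalent_pairs \<alpha> \<beta> \<gamma> P Q"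
proof -
  have sol: "ghe_solution \<alpha> \<beta> \<gamma> UNIV square_solution"
    using assms(1) by (simp add: ghe_solution_def holo_square_solution pd_pd_square_solution convex_connected)
  show ?thesis
  proof
    assume eq: "equivalent_pairs \<alpha> \<beta> \<gamma> P Q"
    have "same_span_at UNIV (P square_solution 0) (Q square_solution 0) 0"
      by (rule eq[unfolded equivalent_pairs_def, rule_format]) (simp add: sol pd_pd_square_solution)
    with assms(2) show False ..
  qed
qed

text \<open>A function annihilated by the pair but not by \<open>Z\<close> separates
  \<open>Z\<close> from the span.\<close>

lemma not_spanned_at:
  assumes "holo f \<Omega>" "Z f z \<noteq> 0" "fst P f z = 0" "snd P f z = 0"
  shows "\<not> spanned_at \<Omega> Z P z"
  using assms unfolding spanned_at_def by auto

theorem theorem2p1: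
  fixes \<alpha> \<beta> \<gamma> :: complex
  assumes "\<alpha> + \<beta> + \<gamma> = 0"
  shows "is_lax_pair \<alpha> \<beta> \<gamma> (lax_pair_1 \<beta> \<gamma>) \<and>
         is_lax_pair \<alpha> \<beta> \<gamma> (lax_pair_2 \<beta> \<gamma>) \<and>
         is_lax_pair \<alpha> \<beta> \<gamma> (lax_pair_3 \<beta> \<gamma>) \<and>
         \<not> equivalent_pairs \<alpha> \<beta> \<gamma> (lax_pair_1 \<beta> \<gamma>) (lax_pair_2 \<beta> \<gamma>) \<and>
         \<not> equivalent_pairs \<alpha> \<beta> \<gamma> (lax_pair_1 \<beta> \<gamma>) (lax_pair_3 \<beta> \<gamma>) \<and>
         \<not> equivalent_pairs \<alpha> \<beta> \<gamma> (lax_pair_2 \<beta> \<gamma>) (lax_pair_3 \<beta> \<gamma>) \<and>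
         determines_recursion_operator \<alpha> \<beta> \<gamma> 3 4 (relations_1 \<beta> \<gamma>) \<and>
         determines_recursion_operator \<alpha> \<beta> \<gamma> 1 2 (relations_2 \<beta> \<gamma>) \<and>
         determines_recursion_operator \<alpha> \<beta> \<gamma> 1 2 (relations_3 \<beta> \<gamma>)"
proof (intro conjI)
  show "is_lax_pair \<alpha> \<beta> \<gamma> (lax_pair_1 \<beta> \<gamma>)"
    by (rule is_lax_pairI[OF assms, of 1 2 3 4 _ 1]) (simp_all add: lax_pair_1_def)
  \<comment> \<open>The factor \<open>-1\<close> reverses the index pairs in the first operator: in
    this order it is written with \<open>L u 3 2 1\<close> and \<open>L u 3 1 2\<close>.\<close>
  show "is_lax_pair \<alpha> \<beta> \<gamma> (lax_pair_2 \<beta> \<gamma>)"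
    by (rule is_lax_pairI[OF assms, of 3 4 1 2 _ "-1"])
      (simp_all add: lax_pair_2_def L_def fun_eq_iff algebra_simps)
  show "is_lax_pair \<alpha> \<beta> \<gamma> (lax_pair_3 \<beta> \<gamma>)"
    by (rule is_lax_pairI[OF assms, of 4 3 2 1 _ 1]) (simp_all add: lax_pair_3_def)
  \<comment> \<open>On the test solution with parameter 0, \<open>L u i j k\<close> is
    \<open>pd i - pd j\<close>. Up to sign, the pairs consist of \<open>pd 1 - pd 4\<close>,
    \<open>pd 2 - pd 4\<close>; then \<open>pd 2 - pd 3\<close>, \<open>pd 2 - pd 4\<close>; then
    \<open>pd 4 - pd 1\<close>, \<open>pd 3 - pd 1\<close>. The first coordinate is annihilated by
    the second pair but not by the first, and the second coordinate by the third pair but not by the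
    others.\<close>
  note span = same_span_at_def lax_pair_1_def lax_pair_2_def lax_pair_3_def
  show "\<not> equivalent_pairs \<alpha> \<beta> \<gamma> (lax_pair_1 \<beta> \<gamma>) (lax_pair_2 \<beta> \<gamma>)"
    using not_spanned_at[OF holo_component[of 1]]
    by (intro not_equivalent_pairsI[OF assms]) (simp add: span L_square_solution_component)
  show "\<not> equivalent_pairs \<alpha> \<beta> \<gamma> (lax_pair_1 \<beta> \<gamma>) (lax_pair_3 \<beta> \<gamma>)"
    using not_spanned_at[OF holo_component[of 2]]
    by (intro not_equivalent_pairsI[OF assms]) (simp add: span L_square_solution_component)
  show "\<not> equivalent_pairs \<alpha> \<beta> \<gamma> (lax_pair_2 \<beta> \<gamma>) (lax_pair_3 \<beta> \<gamma>)"
    using not_spanned_at[OF holo_component[of 2]]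
    by (intro not_equivalent_pairsI[OF assms]) (simp add: span L_square_solution_component)
  show "determines_recursion_operator \<alpha> \<beta> \<gamma> 3 4 (relations_1 \<beta> \<gamma>)"
    by (rule determines_recursion_operatorI[OF assms, of 1 2 3 4]) (simp_all add: relations_1_def)
  show "determines_recursion_operator \<alpha> \<beta> \<gamma> 1 2 (relations_2 \<beta> \<gamma>)"
    by (rule determines_recursion_operatorI[OF assms, of 3 4 1 2])
      (simp, simp, simp add: relations_2_def L_def algebra_simps eq_commute)
  show "determines_recursion_operator \<alpha> \<beta> \<gamma> 1 2 (relations_3 \<beta> \<gamma>)"
    by (rule determines_recursion_operatorI[OF assms, of 4 3 2 1]) (simp_all add: relations_3_def)
qed

end
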